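(* For every integer $n\ge 0$, every complete metric space $Y$ of generalized non-positive curvature satisfies $\mathrm{LC}(B^{n+1},\lambda_n)$ for $$\lambda_n=\sqrt{1+c_n^2},\qquad c_n=\frac{1}{\mathrm{Vol}(S^n)}\int_{S^n}|x-q|\,\mathrm{d}x,$$ where $q$ is an arbitrary point of $S^n$. In particular, such spaces are Lipschitz $n$-connected with constant $\sqrt3$ for every $n$.
   Context: $B^{m}\subset\mathbb{R}^{m}$ is the closed Euclidean unit ball, $S^{m-1}=\partial B^{m}$, both with the metric induced by the Euclidean norm $|\cdot|$; $\mathrm{d}x$ and $\mathrm{Vol}$ refer to the Riemannian volume measure on $S^n$ (counting measure if $n=0$); $c_n$ does not depend on $q$. A metric space $Y$ is a space of generalized non-positive curvature if it admits a symmetric map $m\colon Y\times Y\to Y$ such that $m(y,y)=y$ for all $y\in Y$ and $d(m(x,y),m(x,z))\le\tfrac12 d(y,z)$ for all $x,y,z\in Y$. For a convex body $K\subset\mathbb{R}^k$ (compact convex set with non-empty interior), $Y$ satisfies $\mathrm{LC}(K,\lambda)$ if for every $L$ every $L$-Lipschitz map $f\colon\partial K\to Y$ admits a $\lambda L$-Lipschitz extension $F\colon K\to Y$. $Y$ is Lipschitz $n$-connected with constant $\lambda$ if it satisfies $\mathrm{LC}(B^{m+1},\lambda)$ for every $0\le m\le n$. *)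

theory Defs
  imports "HOL-Analysis.Analysis" "Jordan_Normal_Form.Determinant"
begin

text \<open>
  The dimension varies inside the statement, so \<open>\<real>\<^sup>k\<close> is the carrier of
  \<^term>\<open>Euclidean_space k\<close>: the functions \<^typ>\<open>nat \<Rightarrow> real\<close> that vanish from index \<open>k\<close> on.
  The metric is given explicitly, because the \<^const>\<open>dist\<close> of \<^typ>\<open>nat \<Rightarrow> real\<close> is not the
  Euclidean one. The sphere \<open>S\<^sup>n\<close> is \<^term>\<open>topspace (nsphere n)\<close>.
\<close>

definition edist :: "nat \<Rightarrow> (nat \<Rightarrow> real) \<Rightarrow> (nat \<Rightarrow> real) \<Rightarrow> real" where
  "edist k x y = L2_set (\<lambda>i. x i - y i) {..<k}"

definition unit_eball :: "nat \<Rightarrow> (nat \<Rightarrow> real) set" where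
  "unit_eball k = {x \<in> topspace (Euclidean_space k). edist k x (\<lambda>_. 0) \<le> 1}"

text \<open>As in \<^const>\<open>lipschitz_on\<close>, the constant is required to be nonnegative.\<close>

definition elipschitz_on ::
  "nat \<Rightarrow> real \<Rightarrow> (nat \<Rightarrow> real) set \<Rightarrow> ((nat \<Rightarrow> real) \<Rightarrow> 'a::metric_space) \<Rightarrow> bool" where
  "elipschitz_on k L A f \<longleftrightarrow>
     0 \<le> L \<and> (\<forall>x\<in>A. \<forall>y\<in>A. dist (f x) (f y) \<le> L * edist k x y)"

text \<open>\<open>LC k K c Y\<close> is meant for convex bodies \<open>K \<subseteq> \<real>\<^sup>k\<close>.\<close>

definition LC :: "nat \<Rightarrow> (nat \<Rightarrow> real) set \<Rightarrow> real \<Rightarrow> 'a::metric_space set \<Rightarrow> bool" where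
  "LC k K c Y \<longleftrightarrow>
     (\<forall>L f. f \<in> (Euclidean_space k frontier_of K) \<rightarrow> Y
        \<and> elipschitz_on k L (Euclidean_space k frontier_of K) f \<longrightarrow>
        (\<exists>F. F \<in> K \<rightarrow> Y \<and> elipschitz_on k (c * L) K F
           \<and> (\<forall>x \<in> Euclidean_space k frontier_of K. F x = f x)))"

definition Lipschitz_connected :: "nat \<Rightarrow> real \<Rightarrow> 'a::metric_space set \<Rightarrow> bool" where
  "Lipschitz_connected n c Y \<longleftrightarrow> (\<forall>m\<le>n. LC (Suc m) (unit_eball (Suc m)) c Y)"

definition generalized_nonpos_curved :: "'a::metric_space set \<Rightarrow> bool" where
  "generalized_nonpos_curved Y \<longleftrightarrow>
     (\<exists>m. (\<forall>x\<in>Y. \<forall>y\<in>Y. m x y \<in> Y \<and> m x y = m y x)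
        \<and> (\<forall>y\<in>Y. m y y = y)
        \<and> (\<forall>x\<in>Y. \<forall>y\<in>Y. \<forall>z\<in>Y. dist (m x y) (m x z) \<le> 1/2 * dist y z))"

text \<open>
  The Riemannian volume of \<open>S\<^sup>n \<subseteq> \<real>\<^bsup>n+1\<^esup>\<close> is \<open>\<surd>det g du\<close> in local coordinates, where \<open>g\<close> is the
  pulled-back metric. The parametrizations of the two open hemispheres (\<open>s = \<plusminus>1\<close>) as graphs over
  the open unit ball of \<open>\<real>\<^sup>n\<close> cover \<open>S\<^sup>n\<close> up to the equator, a null set for \<open>n \<ge> 1\<close> and empty for
  \<open>n = 0\<close>. For \<open>n = 0\<close> the product measure is a unit point mass and the determinant is \<open>1\<close>, so one
  gets the counting measure on \<open>S\<^sup>0\<close>. Points \<open>u\<close> of the product space are only used at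
  indices below \<open>n\<close>.
\<close>

definition hemisphere_param :: "nat \<Rightarrow> real \<Rightarrow> (nat \<Rightarrow> real) \<Rightarrow> (nat \<Rightarrow> real)" where
  "hemisphere_param n s u =
     (\<lambda>i. if i < n then u i else if i = n then s * sqrt (1 - (\<Sum>j<n. (u j)\<^sup>2)) else 0)"

definition pullback_metric ::
  "nat \<Rightarrow> ((nat \<Rightarrow> real) \<Rightarrow> (nat \<Rightarrow> real)) \<Rightarrow> (nat \<Rightarrow> real) \<Rightarrow> real mat" where
  "pullback_metric n \<phi> u =
     mat n n (\<lambda>(i, j). \<Sum>k\<le>n. deriv (\<lambda>t. \<phi> (u(i := t)) k) (u i)
                              * deriv (\<lambda>t. \<phi> (u(j := t)) k) (u j))"

definition sphere_volume :: "nat \<Rightarrow> (nat \<Rightarrow> real) measure" where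
  "sphere_volume n =
     distr
       (density
          (count_space {-1, 1} \<Otimes>\<^sub>M
             restrict_space (\<Pi>\<^sub>M i\<in>{..<n}. lborel) {u. (\<Sum>j<n. (u j)\<^sup>2) < 1})
          (\<lambda>(s, u). ennreal (sqrt (Determinant.det (pullback_metric n (hemisphere_param n s) u)))))
       (restrict_space borel (topspace (nsphere n)))
       (\<lambda>(s, u). hemisphere_param n s u)"

definition mean_dist :: "nat \<Rightarrow> (nat \<Rightarrow> real) \<Rightarrow> real" where
  "mean_dist n q =
     (\<integral>x. edist (Suc n) x q \<partial>sphere_volume n)
       / measure (sphere_volume n) (topspace (nsphere n))"

end

theory Submission
  imports Defs "HOL-Probability.Weak_Convergence" "HOL-Probability.Distributions"
    "HOL-Probability.Infinite_Product_Measure"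
begin

text \<open>
  Iterating the midpoint map over dyadic numbers gives geodesics along which \<open>Y\<close> contracts towards
  their common starting point. So if some \<open>b \<in> Y\<close> satisfies \<open>d(b, f(q)) \<le> c L\<close> for all \<open>q\<close> in the
  sphere, coning off \<open>f\<close> at \<open>b\<close> gives an extension with constant \<open>\<surd>(1 + c\<^sup>2) L\<close>, because
  \<open>|r p - s q|\<^sup>2 = (r - s)\<^sup>2 + r s |p - q|\<^sup>2\<close> for unit vectors.

  The point \<open>b\<close> is a barycenter of the image of the normalised sphere volume under \<open>f\<close>. A tournament of
  midpoints over the \<open>2\<^sup>k\<close> boxes of a dyadic subdivision of the unit cube contracts the \<open>L\<^sup>1\<close> distance
  of maps from the cube to \<open>Y\<close>, and it does not change when the boxes are halved further. The
  tournaments therefore converge for the map obtained by composing \<open>f\<close> with the coordinatewise normal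
  quantile function and the radial projection, which takes the uniform measure of the cube to the
  normalised volume of the sphere. This last fact is the polar decomposition of the Gaussian measure.
  Since a plane rotation is a product of three shears, the Gaussian measure is rotation invariant, so
  \<open>c\<^sub>n\<close> does not depend on \<open>q\<close>. Finally \<open>c\<^sub>n \<le> \<surd>2\<close> because \<open>|x - q| + |x + q| \<le> 2 \<surd>2\<close> on the sphere.
\<close>

section \<open>Conical geodesics from midpoints\<close>

text \<open>The bound on the distance from \<open>b\<close> to \<open>f(q)\<close> is Jensen's
  inequality for the barycenter \<open>b\<close>. A midpoint map supplies such an inequality only
  for two points of weight 1/2 and can be iterated only along binary trees, so the measure must be
  cut again and again into two halves of equal mass that look like the whole. The uniform measure on
  the cube has this self-similarity in every coordinate, which is why \<open>f\<close> is pulled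
  back to the cube. The outcome of a tournament may depend on the pairing of the boxes; no canonical
  barycenter is claimed, only a limit along one fixed scheme. For the limit, the parametrization of
  the sphere has to be approximated in mean by its values at box centres, and continuity almost
  everywhere suffices. The Gaussian serves twice: as a product measure it is reached from the cube
  coordinate by coordinate, and as a rotation invariant measure it projects uniformly to the sphere.
  The square root in the constant is a Cauchy-Schwarz inequality: tangential motion in the cone
  costs \<open>L\<close> per unit length, radial motion \<open>c L\<close>.\<close>

primrec dyadic_floor :: "nat \<Rightarrow> real \<Rightarrow> real" where
  "dyadic_floor 0 t = 0"
| "dyadic_floor (Suc k) t =
     (if t \<le> 1/2 then dyadic_floor k (2 * t) / 2 else 1/2 + dyadic_floor k (2 * t - 1) / 2)"

lemma dyadic_floor_nonneg: "0 \<le> dyadic_floor k t"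
  by (induction k arbitrary: t) auto

lemma dyadic_floor_le_1: "dyadic_floor k t \<le> 1"
proof (induction k arbitrary: t)
  case (Suc k)
  show ?case using Suc[of "2*t"] Suc[of "2*t-1"] by auto
qed auto

text \<open>For \<open>t\<close> in (0, 1], \<open>dyadic_floor k t\<close> is the largest multiple
  of \<open>1 / 2 ^ k\<close> strictly below \<open>t\<close>; it is \<open>1 - 1 / 2 ^ k\<close> at
  \<open>t = 1\<close>, because the recursion sends 1/2 to the left half. Every doubling of the
  argument halves the error.\<close>

lemma dyadic_floor_error:
  assumes "0 \<le> t" "t \<le> 1"
  shows "\<bar>dyadic_floor k t - t\<bar> \<le> 1 / 2 ^ k"
  using assms
proof (induction k arbitrary: t)
  case (Suc k)
  show ?case using Suc(1)[of "2*t"] Suc(1)[of "2*t-1"] Suc(2,3) by (auto simp: field_simps)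
qed auto

lemma dyadic_floor_tendsto:
  assumes "0 \<le> t" "t \<le> 1"
  shows "(\<lambda>k. dyadic_floor k t) \<longlonglongrightarrow> t"
proof -
  have "(\<lambda>k. dyadic_floor k t - t) \<longlonglongrightarrow> 0"
  proof (rule Lim_null_comparison)
    show "\<forall>\<^sub>F k in sequentially. norm (dyadic_floor k t - t) \<le> (1/2) ^ k"
      using dyadic_floor_error[OF assms] by (simp add: power_divide)
  qed (auto intro: LIMSEQ_power_zero)
  then show ?thesis by (simp add: LIM_zero_iff)
qed

locale midpoint_space =
  fixes Y :: "'a::metric_space set" and mid :: "'a \<Rightarrow> 'a \<Rightarrow> 'a"
  assumes mid_in: "\<lbrakk>x \<in> Y; y \<in> Y\<rbrakk> \<Longrightarrow> mid x y \<in> Y"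
    and mid_commute: "\<lbrakk>x \<in> Y; y \<in> Y\<rbrakk> \<Longrightarrow> mid x y = mid y x"
    and mid_idem: "y \<in> Y \<Longrightarrow> mid y y = y"
    and mid_contract: "\<lbrakk>x \<in> Y; y \<in> Y; z \<in> Y\<rbrakk> \<Longrightarrow> dist (mid x y) (mid x z) \<le> 1/2 * dist y z"
begin

text \<open>One argument is moved at a time; symmetry of \<open>mid\<close> turns contraction in the
  second argument into contraction in the first.\<close>

lemma dist_mid_le:
  assumes "x \<in> Y" "y \<in> Y" "x' \<in> Y" "y' \<in> Y"
  shows "dist (mid x y) (mid x' y') \<le> (dist x x' + dist y y') / 2"
proof -
  have "dist (mid x y) (mid x' y') \<le> dist (mid x y) (mid x y') + dist (mid x y') (mid x' y')"
    by (rule dist_triangle)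
  also have "dist (mid x y) (mid x y') \<le> 1/2 * dist y y'"
    using assms by (intro mid_contract)
  also have "dist (mid x y') (mid x' y') \<le> 1/2 * dist x x'"
    using assms mid_contract[of y' x x'] by (simp add: mid_commute)
  finally show ?thesis by (simp add: field_simps)
qed

lemma dist_mid_left: "\<lbrakk>x \<in> Y; y \<in> Y\<rbrakk> \<Longrightarrow> dist x (mid x y) \<le> dist x y / 2"
  using dist_mid_le[of x x x y] by (simp add: mid_idem)

lemma dist_mid_right: "\<lbrakk>x \<in> Y; y \<in> Y\<rbrakk> \<Longrightarrow> dist (mid x y) y \<le> dist x y / 2"
  using dist_mid_le[of x y y y] by (simp add: mid_idem)

text \<open>Bisection towards the parameter \<open>t\<close>: the left end of the piece that remains
  after \<open>k\<close> halvings. The case split is that of \<open>dyadic_floor\<close>, whose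
  value is the weight of \<open>y\<close> in the point returned.\<close>

primrec dyadic_point :: "nat \<Rightarrow> real \<Rightarrow> 'a \<Rightarrow> 'a \<Rightarrow> 'a" where
  "dyadic_point 0 t x y = x"
| "dyadic_point (Suc k) t x y =
     (if t \<le> 1/2 then dyadic_point k (2 * t) x (mid x y)
      else dyadic_point k (2 * t - 1) (mid x y) y)"

lemma dyadic_point_in: "\<lbrakk>x \<in> Y; y \<in> Y\<rbrakk> \<Longrightarrow> dyadic_point k t x y \<in> Y"
  by (induction k arbitrary: t x y) (auto intro: mid_in)

text \<open>The distance bound interpolates affinely between the ends: \<open>dist_mid_le\<close> is
  the case of weights 1/2, and on each half the weights rescale exactly as
  \<open>dyadic_floor\<close> does.\<close>

lemma dyadic_point_contract:
  assumes "x \<in> Y" "y \<in> Y" "x' \<in> Y" "y' \<in> Y"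
  shows "dist (dyadic_point k t x y) (dyadic_point k t x' y')
    \<le> (1 - dyadic_floor k t) * dist x x' + dyadic_floor k t * dist y y'"
  using assms
proof (induction k arbitrary: t x y x' y')
  case (Suc k)
  define M where "M = mid x y"
  define M' where "M' = mid x' y'"
  have M: "M \<in> Y" "M' \<in> Y" "dist M M' \<le> (dist x x' + dist y y') / 2"
    using Suc.prems dist_mid_le by (auto simp: M_def M'_def mid_in)
  show ?case
  proof (cases "t \<le> 1/2")
    case True
    define a where "a = dyadic_floor k (2 * t)"
    have "dist (dyadic_point k (2*t) x M) (dyadic_point k (2*t) x' M') \<le> (1 - a) * dist x x' + a * dist M M'"
      unfolding a_def using Suc M by blast
    also have "a * dist M M' \<le> a * ((dist x x' + dist y y') / 2)"
      using M(3) by (intro mult_left_mono) (auto simp: a_def dyadic_floor_nonneg)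
    finally show ?thesis using True by (simp add: a_def M_def M'_def field_simps)
  next
    case False
    define a where "a = dyadic_floor k (2 * t - 1)"
    have "dist (dyadic_point k (2*t-1) M y) (dyadic_point k (2*t-1) M' y') \<le> (1 - a) * dist M M' + a * dist y y'"
      unfolding a_def using Suc M by blast
    also have "(1 - a) * dist M M' \<le> (1 - a) * ((dist x x' + dist y y') / 2)"
      using M(3) by (intro mult_left_mono) (auto simp: a_def dyadic_floor_le_1)
    finally show ?thesis using False by (simp add: a_def M_def M'_def field_simps)
  qed
qed simp

text \<open>Comparison with the path from \<open>x\<close> to \<open>x\<close>, which idempotence of
  \<open>mid\<close> keeps constant.\<close>

lemma dist_dyadic_point_left:
  assumes "x \<in> Y" "y \<in> Y"
  shows "dist x (dyadic_point k t x y) \<le> dyadic_floor k t * dist x y"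
proof -
  have "dyadic_point k t x x = x" using assms(1)
    by (induction k arbitrary: t) (auto simp: mid_idem)
  then show ?thesis using dyadic_point_contract[of x x x y k t] assms by simp
qed

lemma dist_dyadic_point_right:
  assumes "x \<in> Y" "y \<in> Y"
  shows "dist (dyadic_point k t x y) y \<le> (1 - dyadic_floor k t) * dist x y"
proof -
  have "dyadic_point k t y y = y" using assms(2)
    by (induction k arbitrary: t) (auto simp: mid_idem)
  then show ?thesis using dyadic_point_contract[of x y y y k t] assms by simp
qed

text \<open>The ends of each half are at most half as far apart as \<open>x\<close> and
  \<open>y\<close>. Parameters in one half are handled by induction, parameters in different halves
  are joined through the midpoint.\<close>

lemma dist_dyadic_point:
  assumes "x \<in> Y" "y \<in> Y"
  shows "dist (dyadic_point k s x y) (dyadic_point k t x y)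
    \<le> \<bar>dyadic_floor k s - dyadic_floor k t\<bar> * dist x y"
  using assms
proof (induction k arbitrary: s t x y)
  case (Suc k)
  define M where "M = mid x y"
  have M: "M \<in> Y" "dist x M \<le> dist x y / 2" "dist M y \<le> dist x y / 2"
    using Suc.prems dist_mid_left dist_mid_right by (auto simp: M_def mid_in)
  have across: "dist (dyadic_point k a x M) (dyadic_point k b M y)
      \<le> (1/2 + dyadic_floor k b / 2 - dyadic_floor k a / 2) * dist x y" for a b
  proof -
    have "dist (dyadic_point k a x M) (dyadic_point k b M y)
      \<le> dist (dyadic_point k a x M) M + dist M (dyadic_point k b M y)" by (rule dist_triangle)
    also have "\<dots> \<le> (1 - dyadic_floor k a) * dist x M + dyadic_floor k b * dist M y"
      using Suc.prems M by (intro add_mono dist_dyadic_point_left dist_dyadic_point_right)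
    also have "\<dots> \<le> (1 - dyadic_floor k a) * (dist x y / 2) + dyadic_floor k b * (dist x y / 2)"
      using M by (intro add_mono mult_left_mono) (auto simp: dyadic_floor_nonneg dyadic_floor_le_1)
    finally show ?thesis by (simp add: field_simps)
  qed
  have left: "dist (dyadic_point k a x M) (dyadic_point k b x M)
      \<le> \<bar>dyadic_floor k a - dyadic_floor k b\<bar> * (dist x y / 2)" for a b
    using Suc.IH[OF Suc.prems(1) M(1), of a b] M(2) by (meson abs_ge_zero mult_left_mono order_trans)
  have right: "dist (dyadic_point k a M y) (dyadic_point k b M y)
      \<le> \<bar>dyadic_floor k a - dyadic_floor k b\<bar> * (dist x y / 2)" for a b
    using Suc.IH[OF M(1) Suc.prems(2), of a b] M(3) by (meson abs_ge_zero mult_left_mono order_trans)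
  have half: "\<bar>a / 2 - b / 2\<bar> = \<bar>a - b\<bar> / 2" for a b :: real by (simp add: abs_if field_simps)
  have abs1: "\<bar>1/2 + dyadic_floor k b / 2 - dyadic_floor k a / 2\<bar> = 1/2 + dyadic_floor k b / 2 - dyadic_floor k a / 2"
    "\<bar>dyadic_floor k a / 2 - (1/2 + dyadic_floor k b / 2)\<bar> = 1/2 + dyadic_floor k b / 2 - dyadic_floor k a / 2" for a b
    using dyadic_floor_nonneg[of k b] dyadic_floor_le_1[of k a] by auto
  consider "s \<le> 1/2" "t \<le> 1/2" | "s \<le> 1/2" "\<not> t \<le> 1/2" | "\<not> s \<le> 1/2" "t \<le> 1/2" | "\<not> s \<le> 1/2" "\<not> t \<le> 1/2"
    by blast
  then show ?case
  proof cases
    case 1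
    then show ?thesis using left[of "2 * s" "2*t"] by (simp add: M_def half)
  next
    case 2
    then show ?thesis using across[of "2 * s" "2*t-1"] by (simp add: M_def abs1)
  next
    case 3
    then show ?thesis using across[of "2*t" "2 * s - 1"]
      by (simp add: M_def abs1 dist_commute)
  next
    case 4
    then show ?thesis using right[of "2 * s - 1" "2*t-1"] by (simp add: M_def half)
  qed
qed simp

text \<open>Both levels make the same first \<open>k\<close> choices and thus reach the same piece,
  whose ends are at most \<open>dist x y / 2 ^ k\<close> apart.\<close>

lemma dist_dyadic_point_levels:
  assumes "x \<in> Y" "y \<in> Y"
  shows "dist (dyadic_point k t x y) (dyadic_point (k + j) t x y) \<le> dist x y / 2 ^ k"
  using assms
proof (induction k arbitrary: t x y)
  case 0
  have "dist x (dyadic_point j t x y) \<le> dyadic_floor j t * dist x y"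
    using 0 by (rule dist_dyadic_point_left)
  also have "\<dots> \<le> 1 * dist x y" by (intro mult_right_mono dyadic_floor_le_1) simp
  finally show ?case by simp
next
  case (Suc k)
  define M where "M = mid x y"
  have M: "M \<in> Y" "dist x M \<le> dist x y / 2" "dist M y \<le> dist x y / 2"
    using Suc.prems dist_mid_left dist_mid_right by (auto simp: M_def mid_in)
  have "dist x M / 2^k \<le> dist x y / 2 / 2^k" "dist M y / 2^k \<le> dist x y / 2 / 2^k"
    using M by (intro divide_right_mono; simp)+
  then have "dist (dyadic_point k (2*t) x M) (dyadic_point (k+j) (2*t) x M) \<le> dist x y / 2^Suc k"
    "dist (dyadic_point k (2*t-1) M y) (dyadic_point (k+j) (2*t-1) M y) \<le> dist x y / 2^Suc k"
    using Suc.IH[OF Suc.prems(1) M(1), of "2*t"] Suc.IH[OF M(1) Suc.prems(2), of "2*t-1"]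
    by (simp_all add: mult.commute)
  then show ?case by (simp add: M_def)
qed

lemma dyadic_point_converges:
  assumes "complete Y" "x \<in> Y" "y \<in> Y"
  obtains l where "l \<in> Y" "(\<lambda>k. dyadic_point k t x y) \<longlonglongrightarrow> l"
proof -
  have lim0: "(\<lambda>k. dist x y / 2 ^ k) \<longlonglongrightarrow> 0"
    using tendsto_mult_right_zero[OF LIMSEQ_power_zero[of "1/2::real"], of "dist x y"]
    by (simp add: power_divide)
  have "Cauchy (\<lambda>k. dyadic_point k t x y)"
  proof (rule CauchyI')
    fix e :: real assume "0 < e"
    then obtain K where K: "\<And>k. k \<ge> K \<Longrightarrow> dist x y / 2 ^ k < e"
      using order_tendstoD(2)[OF lim0] by (metis eventually_sequentially)
    show "\<exists>K. \<forall>a\<ge>K. \<forall>b>a. dist (dyadic_point a t x y) (dyadic_point b t x y) < e"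
    proof (intro exI allI impI)
      fix a b assume "K \<le> a" "a < b"
      then show "dist (dyadic_point a t x y) (dyadic_point b t x y) < e"
        using dist_dyadic_point_levels[OF assms(2,3), of a t "b - a"] K[of a] by auto
    qed
  qed
  moreover have "\<forall>k. dyadic_point k t x y \<in> Y" using assms by (auto intro: dyadic_point_in)
  ultimately show ?thesis using assms(1) that by (auto elim!: completeE)
qed

text \<open>These are the two estimates that a cone with apex \<open>x\<close> requires: the speed
  along one ray, and the contraction between rays that share the apex.\<close>

lemma ex_conical_geodesics:
  assumes "complete Y"
  obtains \<gamma> :: "real \<Rightarrow> 'a \<Rightarrow> 'a \<Rightarrow> 'a" where
    "\<And>t x y. \<lbrakk>x \<in> Y; y \<in> Y\<rbrakk> \<Longrightarrow> \<gamma> t x y \<in> Y"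
    "\<And>x y. \<lbrakk>x \<in> Y; y \<in> Y\<rbrakk> \<Longrightarrow> \<gamma> 1 x y = y"
    "\<And>s t x y. \<lbrakk>x \<in> Y; y \<in> Y; s \<in> {0..1}; t \<in> {0..1}\<rbrakk> \<Longrightarrow> dist (\<gamma> s x y) (\<gamma> t x y) \<le> \<bar>s - t\<bar> * dist x y"
    "\<And>t x y y'. \<lbrakk>x \<in> Y; y \<in> Y; y' \<in> Y; t \<in> {0..1}\<rbrakk> \<Longrightarrow> dist (\<gamma> t x y) (\<gamma> t x y') \<le> t * dist y y'"
proof -
  define \<gamma> where "\<gamma> t x y = lim (\<lambda>k. dyadic_point k t x y)" for t x y
  have \<gamma>: "\<gamma> t x y \<in> Y" "(\<lambda>k. dyadic_point k t x y) \<longlonglongrightarrow> \<gamma> t x y" if xy: "x \<in> Y" "y \<in> Y" for t x y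
  proof -
    obtain l where "l \<in> Y" "(\<lambda>k. dyadic_point k t x y) \<longlonglongrightarrow> l"
      using dyadic_point_converges[OF assms xy] .
    then show "\<gamma> t x y \<in> Y" "(\<lambda>k. dyadic_point k t x y) \<longlonglongrightarrow> \<gamma> t x y"
      by (simp_all add: \<gamma>_def limI)
  qed
  show ?thesis
  proof (rule that[of \<gamma>])
    fix t x y assume "x \<in> Y" "y \<in> Y"
    then show "\<gamma> t x y \<in> Y" by (rule \<gamma>)
  next
    fix x y assume xy: "x \<in> Y" "y \<in> Y"
    \<comment> \<open>At level \<open>k\<close> the weight of \<open>y\<close> is only
      \<open>1 - 1 / 2 ^ k\<close>, so the end point is obtained in the limit.\<close>
    have "dist (\<gamma> 1 x y) y \<le> (1 - 1) * dist x y"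
    proof (rule LIMSEQ_le)
      show "(\<lambda>k. dist (dyadic_point k 1 x y) y) \<longlonglongrightarrow> dist (\<gamma> 1 x y) y"
        by (intro tendsto_intros \<gamma> xy)
      show "(\<lambda>k. (1 - dyadic_floor k 1) * dist x y) \<longlonglongrightarrow> (1 - 1) * dist x y"
        by (intro tendsto_intros dyadic_floor_tendsto) auto
    qed (use dist_dyadic_point_right[OF xy] in blast)
    then show "\<gamma> 1 x y = y" by simp
  next
    fix s t :: real and x y assume xy: "x \<in> Y" "y \<in> Y" and st: "s \<in> {0..1}" "t \<in> {0..1}"
    show "dist (\<gamma> s x y) (\<gamma> t x y) \<le> \<bar>s - t\<bar> * dist x y"
    proof (rule LIMSEQ_le)
      show "(\<lambda>k. dist (dyadic_point k s x y) (dyadic_point k t x y)) \<longlonglongrightarrow> dist (\<gamma> s x y) (\<gamma> t x y)"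
        by (intro tendsto_intros \<gamma> xy)
      show "(\<lambda>k. \<bar>dyadic_floor k s - dyadic_floor k t\<bar> * dist x y) \<longlonglongrightarrow> \<bar>s - t\<bar> * dist x y"
        using st by (intro tendsto_intros dyadic_floor_tendsto) auto
    qed (use dist_dyadic_point[OF xy] in blast)
  next
    fix t :: real and x y y' assume xy: "x \<in> Y" "y \<in> Y" "y' \<in> Y" and t: "t \<in> {0..1}"
    show "dist (\<gamma> t x y) (\<gamma> t x y') \<le> t * dist y y'"
    proof (rule LIMSEQ_le)
      show "(\<lambda>k. dist (dyadic_point k t x y) (dyadic_point k t x y')) \<longlonglongrightarrow> dist (\<gamma> t x y) (\<gamma> t x y')"
        by (intro tendsto_intros \<gamma> xy)
      show "(\<lambda>k. dyadic_floor k t * dist y y') \<longlonglongrightarrow> t * dist y y'"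
        using t by (intro tendsto_intros dyadic_floor_tendsto) auto
    qed (use dyadic_point_contract[OF xy(1,2,1,3)] in auto)
  qed
qed

end

section \<open>Rotation invariance of Gaussian integrals\<close>

abbreviation coord_lborel :: "nat set \<Rightarrow> (nat \<Rightarrow> real) measure" where
  "coord_lborel I \<equiv> Pi\<^sub>M I (\<lambda>_. lborel)"

interpretation lborel_product: product_sigma_finite "\<lambda>_::nat. lborel :: real measure"
  by standard

text \<open>The one-dimensional change of variables \<open>eq\<close> is tensorised by Fubini, one
  coordinate at a time. It serves both the dilations of \<open>coord_lborel\<close> and the normal
  quantile map on the cube.\<close>

lemma nn_integral_PiM_transform:
  fixes N :: "real measure" and T :: "real \<Rightarrow> real" and w :: "real \<Rightarrow> ennreal"
  assumes "sigma_finite_measure N"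
    and T[measurable]: "T \<in> N \<rightarrow>\<^sub>M borel" and w[measurable]: "w \<in> borel_measurable borel"
    and eq: "\<And>f. f \<in> borel_measurable borel \<Longrightarrow> (\<integral>\<^sup>+u. f (T u) \<partial>N) = (\<integral>\<^sup>+x. f x * w x \<partial>lborel)"
    and "finite I" and "F \<in> borel_measurable (coord_lborel I)"
  shows "(\<integral>\<^sup>+u. F (\<lambda>i\<in>I. T (u i)) \<partial>(Pi\<^sub>M I (\<lambda>_. N))) = (\<integral>\<^sup>+x. F x * (\<Prod>i\<in>I. w (x i)) \<partial>coord_lborel I)"
proof -
  interpret N: product_sigma_finite "\<lambda>_::nat. N" using assms(1) by (simp add: product_sigma_finite_def)
  show ?thesis using assms(5,6)
  proof (induction I arbitrary: F rule: finite_induct)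
    case empty
    show ?case
      using N.nn_integral_empty[of "\<lambda>u. F (\<lambda>i\<in>{}. T (u i))"] lborel_product.nn_integral_empty[of F]
      by (simp add: restrict_def del: nn_integral_const)
  next
    case (insert i I)
    note [measurable] = insert.prems
    have upd[measurable]: "(\<lambda>(v, x). v(i := x)) \<in> coord_lborel I \<Otimes>\<^sub>M lborel \<rightarrow>\<^sub>M coord_lborel (insert i I)"
      by (rule measurable_add_dim)
    \<comment> \<open>The new coordinate is integrated out first, already against \<open>w\<close>;
      the induction hypothesis is then applied to \<open>H\<close>.\<close>
    define H where "H v = (\<integral>\<^sup>+x. F (v(i := x)) * w x \<partial>lborel)" for v
    have H[measurable]: "H \<in> borel_measurable (coord_lborel I)"
      unfolding H_def by measurable
    have T'[measurable]: "(\<lambda>u. \<lambda>k\<in>J. T (u k)) \<in> Pi\<^sub>M J (\<lambda>_. N) \<rightarrow>\<^sub>M coord_lborel J" for J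
      by (intro measurable_restrict) measurable
    have "(\<integral>\<^sup>+u. F (\<lambda>k\<in>insert i I. T (u k)) \<partial>Pi\<^sub>M (insert i I) (\<lambda>_. N)) =
      (\<integral>\<^sup>+u. \<integral>\<^sup>+y. F (\<lambda>k\<in>insert i I. T ((u(i := y)) k)) \<partial>N \<partial>Pi\<^sub>M I (\<lambda>_. N))"
      using insert by (subst N.product_nn_integral_insert) auto
    also have "\<dots> = (\<integral>\<^sup>+u. H (\<lambda>k\<in>I. T (u k)) \<partial>Pi\<^sub>M I (\<lambda>_. N))"
    proof (rule nn_integral_cong)
      fix u assume u: "u \<in> space (Pi\<^sub>M I (\<lambda>_. N))"
      have sp: "(\<lambda>k\<in>I. T (u k)) \<in> space (coord_lborel I)" by (simp add: space_PiM)
      have "(\<lambda>k\<in>insert i I. T ((u(i := y)) k)) = (\<lambda>k\<in>I. T (u k))(i := T y)" for y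
        using insert(2) by (auto simp: fun_eq_iff)
      then have "(\<integral>\<^sup>+y. F (\<lambda>k\<in>insert i I. T ((u(i := y)) k)) \<partial>N) = (\<integral>\<^sup>+y. F ((\<lambda>k\<in>I. T (u k))(i := T y)) \<partial>N)"
        by simp
      also have "\<dots> = H (\<lambda>k\<in>I. T (u k))"
        unfolding H_def
      proof (rule eq)
        have "(\<lambda>x. (\<lambda>k\<in>I. T (u k))(i := x)) \<in> lborel \<rightarrow>\<^sub>M coord_lborel (insert i I)"
          using insert(2) by (intro measurable_component_update sp)
        then show "(\<lambda>x. F ((\<lambda>k\<in>I. T (u k))(i := x))) \<in> borel_measurable borel"
          by measurable
      qed
      finally show "(\<integral>\<^sup>+y. F (\<lambda>k\<in>insert i I. T ((u(i := y)) k)) \<partial>N) = H (\<lambda>k\<in>I. T (u k))" .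
    qed
    also have "\<dots> = (\<integral>\<^sup>+v. H v * (\<Prod>k\<in>I. w (v k)) \<partial>coord_lborel I)"
      by (rule insert.IH[OF H])
    also have "\<dots> = (\<integral>\<^sup>+v. \<integral>\<^sup>+x. F (v(i := x)) * (\<Prod>k\<in>insert i I. w ((v(i := x)) k)) \<partial>lborel \<partial>coord_lborel I)"
    proof (rule nn_integral_cong)
      fix v assume v: "v \<in> space (coord_lborel I)"
      have [measurable]: "(\<lambda>x. v(i := x)) \<in> lborel \<rightarrow>\<^sub>M coord_lborel (insert i I)"
        using insert(2) v by (intro measurable_component_update)
      have "(\<Prod>k\<in>insert i I. w ((v(i := x)) k)) = w x * (\<Prod>k\<in>I. w (v k))" for x
        using insert(1,2) by (auto intro!: prod.cong arg_cong2[where f="(*)"])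
      then show "H v * (\<Prod>k\<in>I. w (v k)) = (\<integral>\<^sup>+x. F (v(i := x)) * (\<Prod>k\<in>insert i I. w ((v(i := x)) k)) \<partial>lborel)"
        unfolding H_def by (subst nn_integral_multc[symmetric]) (auto simp: mult.assoc)
    qed
    also have "\<dots> = (\<integral>\<^sup>+x. F x * (\<Prod>k\<in>insert i I. w (x k)) \<partial>coord_lborel (insert i I))"
      using insert(1,2) by (subst lborel_product.product_nn_integral_insert) auto
    finally show ?case .
  qed
qed

lemma nn_integral_coord_scale:
  assumes "finite I" and "F \<in> borel_measurable (coord_lborel I)" and r: "0 < (r::real)"
  shows "(\<integral>\<^sup>+x. F x \<partial>coord_lborel I) = ennreal (r ^ card I) * (\<integral>\<^sup>+x. F (\<lambda>i\<in>I. r * x i) \<partial>coord_lborel I)"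
proof -
  have "(\<integral>\<^sup>+u. f (r * u) \<partial>lborel) = (\<integral>\<^sup>+x. f x * ennreal (1/r) \<partial>lborel)" if [measurable]: "f \<in> borel_measurable borel" for f
  proof -
    have "(\<integral>\<^sup>+x. f x * ennreal (1/r) \<partial>lborel) = (\<integral>\<^sup>+x. f x \<partial>lborel) * ennreal (1/r)"
      by (rule nn_integral_multc) auto
    also have "\<dots> = (ennreal r * ennreal (1/r)) * (\<integral>\<^sup>+u. f (r * u) \<partial>lborel)"
      using r by (subst nn_integral_real_affine[of f r 0]) (auto simp: mult_ac)
    also have "ennreal r * ennreal (1/r) = 1" using r by (simp flip: ennreal_mult)
    finally show ?thesis by simp
  qed
  then have "(\<integral>\<^sup>+x. F (\<lambda>i\<in>I. r * x i) \<partial>coord_lborel I) = (\<integral>\<^sup>+x. F x * (\<Prod>i\<in>I. ennreal (1/r)) \<partial>coord_lborel I)"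
    using assms(1,2) by (intro nn_integral_PiM_transform) (auto simp: sigma_finite_lborel)
  also have "\<dots> = (\<integral>\<^sup>+x. F x \<partial>coord_lborel I) * ennreal ((1/r) ^ card I)"
    using assms(2) r by (subst nn_integral_multc) (auto simp: ennreal_power)
  finally have *: "(\<integral>\<^sup>+x. F (\<lambda>i\<in>I. r * x i) \<partial>coord_lborel I) = (\<integral>\<^sup>+x. F x \<partial>coord_lborel I) * ennreal ((1/r) ^ card I)" .
  have "ennreal (r ^ card I) * ennreal ((1/r) ^ card I) = 1"
    using r by (simp add: power_divide flip: ennreal_mult)
  then show ?thesis unfolding * by (metis mult.assoc mult.commute mult.right_neutral)
qed

lemma measurable_PiM_update:
  assumes "i \<in> I" and h: "h \<in> Pi\<^sub>M I M \<rightarrow>\<^sub>M M i"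
  shows "(\<lambda>x. x(i := h x)) \<in> Pi\<^sub>M I M \<rightarrow>\<^sub>M Pi\<^sub>M I M"
proof -
  have "(\<lambda>x. \<lambda>k\<in>I. if k = i then h x else x k) \<in> Pi\<^sub>M I M \<rightarrow>\<^sub>M Pi\<^sub>M I M"
  proof (rule measurable_restrict)
    fix k assume "k \<in> I"
    then show "(\<lambda>x. if k = i then h x else x k) \<in> Pi\<^sub>M I M \<rightarrow>\<^sub>M M k"
      using h by (cases "k = i") simp_all
  qed
  then show ?thesis
  proof (rule measurable_cong[THEN iffD1, rotated])
    fix x assume "x \<in> space (Pi\<^sub>M I M)"
    then show "(\<lambda>k\<in>I. if k = i then h x else x k) = x(i := h x)"
      using assms(1) by (auto simp: space_PiM fun_eq_iff PiE_def extensional_def)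
  qed
qed

text \<open>Coordinate \<open>i\<close> is integrated with the others frozen. By
  \<open>a_upd\<close> the shift is then constant, and an affine map of slope 1 or -1 on the line
  remains. Shears have \<open>c = 1\<close>; a coordinate reflection has \<open>a = 0\<close> and
  \<open>c = -1\<close>.\<close>

lemma nn_integral_coord_affine:
  assumes "finite I" "i \<in> I" and F[measurable]: "F \<in> borel_measurable (coord_lborel I)"
    and a[measurable]: "a \<in> borel_measurable (coord_lborel I)"
    and a_upd: "\<And>x y. a (x(i := y)) = a x" and c: "\<bar>c\<bar> = (1::real)"
  shows "(\<integral>\<^sup>+x. F (x(i := a x + c * x i)) \<partial>coord_lborel I) = (\<integral>\<^sup>+x. F x \<partial>coord_lborel I)"
proof -
  define J where "J = I - {i}"
  have I: "I = insert i J" "i \<notin> J" "finite J" using assms by (auto simp: J_def)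
  have FJ[measurable]: "F \<in> borel_measurable (coord_lborel (insert i J))" using F I(1) by simp
  have "(\<lambda>x. x(i := a x + c * x i)) \<in> coord_lborel I \<rightarrow>\<^sub>M coord_lborel I"
    using assms(2) by (intro measurable_PiM_update) auto
  then have "(\<lambda>x. F (x(i := a x + c * x i))) \<in> borel_measurable (coord_lborel I)" by measurable
  then have "(\<lambda>x. F (x(i := a x + c * x i))) \<in> borel_measurable (coord_lborel (insert i J))"
    by (simp only: I(1))
  from lborel_product.product_nn_integral_insert[OF I(3,2) this]
  have "(\<integral>\<^sup>+x. F (x(i := a x + c * x i)) \<partial>coord_lborel I)
    = (\<integral>\<^sup>+x. \<integral>\<^sup>+y. F ((x(i := y))(i := a (x(i := y)) + c * (x(i := y)) i)) \<partial>lborel \<partial>coord_lborel J)"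
    by (simp only: I(1))
  also have "\<dots> = (\<integral>\<^sup>+x. \<integral>\<^sup>+y. F (x(i := y)) \<partial>lborel \<partial>coord_lborel J)"
  proof (rule nn_integral_cong)
    fix x assume x: "x \<in> space (coord_lborel J)"
    have "(\<lambda>y. x(i := y)) \<in> lborel \<rightarrow>\<^sub>M coord_lborel (insert i J)"
      using I(2) x by (intro measurable_component_update)
    then have "(\<lambda>y. F (x(i := y))) \<in> borel_measurable borel" by measurable
    then have "(\<integral>\<^sup>+y. F (x(i := y)) \<partial>lborel) = ennreal \<bar>c\<bar> * (\<integral>\<^sup>+y. F (x(i := a x + c * y)) \<partial>lborel)"
      using c by (intro nn_integral_real_affine) auto
    then show "(\<integral>\<^sup>+y. F ((x(i := y))(i := a (x(i := y)) + c * (x(i := y)) i)) \<partial>lborel) = (\<integral>\<^sup>+y. F (x(i := y)) \<partial>lborel)"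
      using c by (simp add: a_upd)
  qed
  also have "\<dots> = (\<integral>\<^sup>+x. F x \<partial>coord_lborel I)"
    unfolding I(1) using I by (intro lborel_product.product_nn_integral_insert[symmetric]) auto
  finally show ?thesis .
qed

section \<open>Rotations of a coordinate plane as products of shears\<close>

definition plane_rotation :: "nat \<Rightarrow> nat \<Rightarrow> real \<Rightarrow> real \<Rightarrow> (nat \<Rightarrow> real) \<Rightarrow> nat \<Rightarrow> real" where
  "plane_rotation i j c s x = x(i := c * x i - s * x j, j := s * x i + c * x j)"

text \<open>For an angle with cosine \<open>c\<close> and sine \<open>s\<close>,
  \<open>\<tau>\<close> is the tangent of half the angle, which has no value for the half turn
  \<open>c = -1\<close>. The factor 1 in the shears matches the shape of
  \<open>nn_integral_coord_affine\<close>.\<close>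

lemma plane_rotation_shears:
  assumes "i \<noteq> j" "c\<^sup>2 + s\<^sup>2 = 1" "c \<noteq> -1"
  defines "\<tau> \<equiv> s / (1 + c)"
  defines "S \<equiv> \<lambda>x::nat \<Rightarrow> real. x(i := - \<tau> * x j + 1 * x i)"
    and "S' \<equiv> \<lambda>x::nat \<Rightarrow> real. x(j := s * x i + 1 * x j)"
  shows "plane_rotation i j c s x = S (S' (S x))"
proof -
  have c: "1 + c \<noteq> 0" using assms(3) by auto
  have 1: "1 - s * \<tau> = c"
    using c assms(2) by (simp add: \<tau>_def field_simps power2_eq_square)
  have 2: "\<tau> + \<tau> * c = s"
  proof -
    have "\<tau> + \<tau> * c = \<tau> * (1 + c)" by (simp only: distrib_left mult_1_right)
    then show ?thesis using c by (simp add: \<tau>_def)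
  qed
  have "s * (x i - \<tau> * x j) + x j = s * x i + (1 - s * \<tau>) * x j"
    by (simp add: algebra_simps)
  then have A: "s * (x i - \<tau> * x j) + x j = s * x i + c * x j" by (simp only: 1)
  have "x i - \<tau> * x j - \<tau> * (s * x i + c * x j) = (1 - s * \<tau>) * x i - (\<tau> + \<tau> * c) * x j"
    by (simp add: algebra_simps)
  then have B: "x i - \<tau> * x j - \<tau> * (s * x i + c * x j) = c * x i - s * x j"
    by (simp only: 1 2)
  show ?thesis
    using assms(1) by (rule_tac ext) (simp add: plane_rotation_def S_def S'_def A B)
qed

lemma nn_integral_plane_rotation:
  assumes "finite I" "i \<in> I" "j \<in> I" "i \<noteq> j" "c\<^sup>2 + s\<^sup>2 = 1" "c \<noteq> -1"
    and F[measurable]: "F \<in> borel_measurable (coord_lborel I)"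
  shows "(\<integral>\<^sup>+x. F (plane_rotation i j c s x) \<partial>coord_lborel I) = (\<integral>\<^sup>+x. F x \<partial>coord_lborel I)"
proof -
  define S where "S = (\<lambda>x::nat \<Rightarrow> real. x(i := - (s / (1 + c)) * x j + 1 * x i))"
  define S' where "S' = (\<lambda>x::nat \<Rightarrow> real. x(j := s * x i + 1 * x j))"
  have [measurable]: "S \<in> coord_lborel I \<rightarrow>\<^sub>M coord_lborel I" "S' \<in> coord_lborel I \<rightarrow>\<^sub>M coord_lborel I"
    unfolding S_def S'_def using assms by (intro measurable_PiM_update; measurable)+
  have rot: "plane_rotation i j c s = (\<lambda>x. S (S' (S x)))"
    unfolding S_def S'_def by (rule ext, rule plane_rotation_shears) (use assms in auto)
  have inv: "(\<integral>\<^sup>+x. F (S x) \<partial>coord_lborel I) = (\<integral>\<^sup>+x. F x \<partial>coord_lborel I)"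
    "(\<integral>\<^sup>+x. F (S' x) \<partial>coord_lborel I) = (\<integral>\<^sup>+x. F x \<partial>coord_lborel I)"
    if "F \<in> borel_measurable (coord_lborel I)" for F
    unfolding S_def S'_def using assms that by (intro nn_integral_coord_affine; auto)+
  have "(\<integral>\<^sup>+x. F (S (S' (S x))) \<partial>coord_lborel I) = (\<integral>\<^sup>+x. F (S (S' x)) \<partial>coord_lborel I)"
    by (rule inv) measurable
  also have "\<dots> = (\<integral>\<^sup>+x. F (S x) \<partial>coord_lborel I)" by (rule inv) measurable
  also have "\<dots> = (\<integral>\<^sup>+x. F x \<partial>coord_lborel I)" by (rule inv) measurable
  finally show ?thesis unfolding rot .
qed

section \<open>The Gaussian mean distance and its invariance under isometries\<close>

definition sqnorm :: "nat \<Rightarrow> (nat \<Rightarrow> real) \<Rightarrow> real" where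
  "sqnorm k x = (\<Sum>i<k. (x i)\<^sup>2)"

definition radial_proj :: "nat \<Rightarrow> (nat \<Rightarrow> real) \<Rightarrow> nat \<Rightarrow> real" where
  "radial_proj k x = (\<lambda>i. if i < k then x i / sqrt (sqnorm k x) else 0)"

lemma edist_eq_sqnorm: "edist k x y = sqrt (sqnorm k (\<lambda>i. x i - y i))"
  by (simp add: edist_def sqnorm_def L2_set_def)

lemma sqnorm_nonneg: "0 \<le> sqnorm k x"
  by (simp add: sqnorm_def sum_nonneg)

lemma edist_nonneg: "0 \<le> edist k x y"
  by (simp add: edist_eq_sqnorm sqnorm_nonneg)

lemma measurable_sqnorm: "sqnorm k \<in> borel_measurable (coord_lborel {..<k})"
  unfolding sqnorm_def by measurable

lemma measurable_radial_proj_coord: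
  "(\<lambda>x. radial_proj k x i) \<in> borel_measurable (coord_lborel {..<k})"
proof (cases "i < k")
  case True
  note measurable_sqnorm[measurable]
  show ?thesis using True unfolding radial_proj_def by simp
qed (simp add: radial_proj_def)

lemma measurable_edist_radial_proj:
  "(\<lambda>x. edist k (radial_proj k x) q) \<in> borel_measurable (coord_lborel {..<k})"
proof -
  note measurable_radial_proj_coord[measurable]
  show ?thesis unfolding edist_eq_sqnorm sqnorm_def by measurable
qed

lemma sqnorm_split:
  assumes "i < k" "j < k" "i \<noteq> j"
  shows "sqnorm k x = (x i)\<^sup>2 + (x j)\<^sup>2 + (\<Sum>l\<in>{..<k} - {i, j}. (x l)\<^sup>2)"
proof -
  have "{..<k} = insert i (insert j ({..<k} - {i, j}))" using assms by auto
  then have "sqnorm k x = (\<Sum>l\<in>insert i (insert j ({..<k} - {i, j})). (x l)\<^sup>2)"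
    by (simp add: sqnorm_def)
  also have "\<dots> = (x i)\<^sup>2 + ((x j)\<^sup>2 + (\<Sum>l\<in>{..<k} - {i, j}. (x l)\<^sup>2))"
    using assms by (subst sum.insert; simp)+
  finally show ?thesis by simp
qed

text \<open>The Gaussian is left unnormalised; its constant \<open>(1 / sqrt (2 * pi)) ^ k\<close>
  enters with the quantile map. A nonnegative extended integral spares all integrability
  conditions.\<close>

definition gauss_mean_dist :: "nat \<Rightarrow> (nat \<Rightarrow> real) \<Rightarrow> ennreal" where
  "gauss_mean_dist k q =
     (\<integral>\<^sup>+x. ennreal (edist k (radial_proj k x) q * exp (- sqnorm k x / 2)) \<partial>coord_lborel {..<k})"

text \<open>Substitute \<open>A x\<close> for \<open>x\<close>: \<open>sq\<close> preserves the
  Gaussian weight, \<open>proj\<close> pulls \<open>A\<close> out of the projection, and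
  \<open>diff\<close> with \<open>sq\<close> makes \<open>A\<close> an isometry, which cancels it
  against \<open>A q\<close>.\<close>

lemma gauss_mean_dist_isometry:
  assumes inv: "\<And>F. F \<in> borel_measurable (coord_lborel {..<k}) \<Longrightarrow>
      (\<integral>\<^sup>+x. F (A x) \<partial>coord_lborel {..<k}) = (\<integral>\<^sup>+x. F x \<partial>coord_lborel {..<k})"
    and sq: "\<And>x. sqnorm k (A x) = sqnorm k x"
    and diff: "\<And>x y. A (\<lambda>i. x i - y i) = (\<lambda>i. A x i - A y i)"
    and proj: "\<And>x. radial_proj k (A x) = A (radial_proj k x)"
  shows "gauss_mean_dist k (A q) = gauss_mean_dist k q"
proof -
  note [measurable] = measurable_sqnorm measurable_edist_radial_proj
  have ed: "edist k (A x) (A y) = edist k x y" for x y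
    by (simp add: edist_eq_sqnorm sq flip: diff)
  show ?thesis unfolding gauss_mean_dist_def
    by (subst inv[symmetric]) (measurable, simp add: proj ed sq)
qed

lemma gauss_mean_dist_rotation:
  assumes ij: "i < k" "j < k" "i \<noteq> j" and cs: "c\<^sup>2 + s\<^sup>2 = 1" "c \<noteq> -1"
  shows "gauss_mean_dist k (plane_rotation i j c s q) = gauss_mean_dist k q"
proof (rule gauss_mean_dist_isometry)
  show sq: "sqnorm k (plane_rotation i j c s x) = sqnorm k x" for x
  proof -
    have "(c * x i - s * x j)\<^sup>2 + (s * x i + c * x j)\<^sup>2 = (c\<^sup>2 + s\<^sup>2) * ((x i)\<^sup>2 + (x j)\<^sup>2)"
      by (simp add: power2_eq_square algebra_simps)
    then show ?thesis using ij cs by (simp add: sqnorm_split[of i k j] plane_rotation_def)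
  qed
  show "radial_proj k (plane_rotation i j c s x) = plane_rotation i j c s (radial_proj k x)" for x
    unfolding radial_proj_def sq
    using ij by (auto simp: plane_rotation_def fun_eq_iff add_divide_distrib diff_divide_distrib)
  show "(\<integral>\<^sup>+x. F (plane_rotation i j c s x) \<partial>coord_lborel {..<k}) = (\<integral>\<^sup>+x. F x \<partial>coord_lborel {..<k})"
    if "F \<in> borel_measurable (coord_lborel {..<k})" for F
    using assms that by (intro nn_integral_plane_rotation) auto
qed (auto simp: plane_rotation_def fun_eq_iff algebra_simps)

lemma gauss_mean_dist_reflection:
  assumes "i < k"
  shows "gauss_mean_dist k (q(i := - q i)) = gauss_mean_dist k q"
proof (rule gauss_mean_dist_isometry[where A="\<lambda>x. x(i := - x i)"])
  show sq: "sqnorm k (x(i := - x i)) = sqnorm k x" for x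
    unfolding sqnorm_def by (intro sum.cong) auto
  show "radial_proj k (x(i := - x i)) = (radial_proj k x)(i := - radial_proj k x i)" for x
    unfolding radial_proj_def sq by (auto simp: fun_eq_iff)
  show "(\<integral>\<^sup>+x. F (x(i := - x i)) \<partial>coord_lborel {..<k}) = (\<integral>\<^sup>+x. F x \<partial>coord_lborel {..<k})"
    if "F \<in> borel_measurable (coord_lborel {..<k})" for F
    using nn_integral_coord_affine[of "{..<k}" i F "\<lambda>_. 0" "-1"] assms that by simp
qed auto

lemma in_nsphere_iff: "q \<in> topspace (nsphere n) \<longleftrightarrow> (\<forall>i>n. q i = 0) \<and> sqnorm (Suc n) q = 1"
  by (auto simp: nsphere topspace_Euclidean_space sqnorm_def lessThan_Suc_atMost Suc_le_eq)

text \<open>Each rotation moves one nonzero coordinate into coordinate \<open>n\<close> and leaves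
  that one positive. A reflection is therefore left only for a point that is the antipode of the
  pole from the start.\<close>

lemma gauss_mean_dist_pole:
  assumes "q \<in> topspace (nsphere n)"
  shows "gauss_mean_dist (Suc n) q = gauss_mean_dist (Suc n) (\<lambda>i. if i = n then 1 else 0)"
  using assms
proof (induction "card {i. i < n \<and> q i \<noteq> 0}" arbitrary: q rule: less_induct)
  case less
  define e where "e = (\<lambda>i. if i = n then 1 else 0 :: real)"
  show ?case
  proof (cases "\<exists>i<n. q i \<noteq> 0")
    case True
    then obtain i where i: "i < n" "q i \<noteq> 0" by auto
    define r where "r = sqrt ((q i)\<^sup>2 + (q n)\<^sup>2)"
    have r2: "r\<^sup>2 = (q i)\<^sup>2 + (q n)\<^sup>2" by (simp add: r_def)
    have r: "r > 0" using i by (simp add: r_def sum_power2_gt_zero_iff)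
    \<comment> \<open>The rotation that takes the pair \<open>(q i, q n)\<close> to
      \<open>(0, r)\<close>. As \<open>q i\<close> is nonzero, so is \<open>s\<close>, which
      excludes \<open>c = -1\<close>.\<close>
    define c where "c = q n / r"
    define s where "s = q i / r"
    have cs: "c\<^sup>2 + s\<^sup>2 = 1"
      using r i by (simp add: c_def s_def power_divide r2 sum_power2_eq_zero_iff add.commute flip: add_divide_distrib)
    have "s \<noteq> 0" using i r by (simp add: s_def)
    then have c1: "c \<noteq> -1" using cs by auto
    define q' where "q' = plane_rotation i n c s q"
    have q'i: "q' i = 0" and q'o: "\<And>l. l \<noteq> i \<Longrightarrow> l \<noteq> n \<Longrightarrow> q' l = q l"
      using i by (auto simp: q'_def plane_rotation_def c_def s_def)
    have "(c * q i - s * q n)\<^sup>2 + (s * q i + c * q n)\<^sup>2 = (c\<^sup>2 + s\<^sup>2) * ((q i)\<^sup>2 + (q n)\<^sup>2)"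
      by (simp add: power2_eq_square algebra_simps)
    then have "sqnorm (Suc n) q' = sqnorm (Suc n) q"
      using i cs by (simp add: sqnorm_split[of i "Suc n" n] plane_rotation_def q'_def)
    then have q': "q' \<in> topspace (nsphere n)"
      using less.prems i q'o by (auto simp: in_nsphere_iff)
    have "{l. l < n \<and> q' l \<noteq> 0} \<subset> {l. l < n \<and> q l \<noteq> 0}"
    proof (rule psubsetI)
      show "{l. l < n \<and> q' l \<noteq> 0} \<subseteq> {l. l < n \<and> q l \<noteq> 0}" using q'i q'o i(2) by (smt (verit) Collect_mono less_irrefl)
      show "{l. l < n \<and> q' l \<noteq> 0} \<noteq> {l. l < n \<and> q l \<noteq> 0}" using i q'i by blast
    qed
    then have "card {l. l < n \<and> q' l \<noteq> 0} < card {l. l < n \<and> q l \<noteq> 0}"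
      by (intro psubset_card_mono) auto
    then have "gauss_mean_dist (Suc n) q' = gauss_mean_dist (Suc n) e"
      using less.hyps q' by (simp add: e_def)
    moreover have "gauss_mean_dist (Suc n) q' = gauss_mean_dist (Suc n) q"
      unfolding q'_def using i cs c1 by (intro gauss_mean_dist_rotation) auto
    ultimately show ?thesis by (simp add: e_def)
  next
    case False
    have "sqnorm (Suc n) q = 1" using less.prems by (simp add: in_nsphere_iff)
    then have "(q n)\<^sup>2 = 1" using False by (simp add: sqnorm_def)
    then have "q n = 1 \<or> q n = -1" by (rule power2_eq_1_iff[THEN iffD1])
    moreover have "q i = 0" if "i \<noteq> n" for i
      using that False less.prems by (cases "i < n") (auto simp: in_nsphere_iff)
    ultimately have "q = e \<or> q(n := - q n) = e" by (auto simp: e_def fun_eq_iff)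
    then show ?thesis using gauss_mean_dist_reflection[of n "Suc n" q] by (auto simp: e_def)
  qed
qed

section \<open>Barycenters of maps from the cube\<close>

text \<open>A density on the whole line, not a restriction to the interval: the sigma-algebra stays
  Borel, so measurability on the cube and on \<open>coord_lborel\<close> is checked alike.\<close>

definition unit_uniform :: "real measure" where
  "unit_uniform = density lborel (indicator {0<..<1})"

lemma sets_unit_uniform[simp, measurable_cong]: "sets unit_uniform = sets borel"
  by (simp add: unit_uniform_def)

lemma space_unit_uniform[simp]: "space unit_uniform = UNIV"
  by (simp add: unit_uniform_def)

lemma prob_space_unit_uniform: "prob_space unit_uniform"
  by (rule prob_spaceI) (simp add: unit_uniform_def emeasure_density)

abbreviation cube_uniform :: "nat set \<Rightarrow> (nat \<Rightarrow> real) measure" where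
  "cube_uniform I \<equiv> Pi\<^sub>M I (\<lambda>_. unit_uniform)"

interpretation uniform_product: product_sigma_finite "\<lambda>_::nat. unit_uniform"
  by (simp add: product_sigma_finite_def prob_space_unit_uniform prob_space_imp_sigma_finite)

lemma prob_space_cube_uniform: "prob_space (cube_uniform I)"
  by (intro prob_space_PiM prob_space_unit_uniform)

lemma nn_integral_unit_uniform:
  assumes [measurable]: "f \<in> borel_measurable borel"
  shows "(\<integral>\<^sup>+u. f u \<partial>unit_uniform) = (\<integral>\<^sup>+u. f u * indicator {0<..<1} u \<partial>lborel)"
  unfolding unit_uniform_def by (subst nn_integral_density) (auto simp: mult.commute)

text \<open>The uniform measure is the average of its images under the two halving maps, with
  exactly the weights of a midpoint.\<close>

lemma nn_integral_unit_uniform_halve: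
  assumes [measurable]: "f \<in> borel_measurable borel"
  shows "(\<integral>\<^sup>+u. f u \<partial>unit_uniform) =
    ennreal (1/2) * ((\<integral>\<^sup>+u. f (u / 2) \<partial>unit_uniform) + (\<integral>\<^sup>+u. f ((u + 1) / 2) \<partial>unit_uniform))"
proof -
  have "(\<integral>\<^sup>+u. f u * indicator {0<..<1} u \<partial>lborel)
    = (\<integral>\<^sup>+u. f u * indicator {0<..<1/2} u + f u * indicator {1/2<..<1} u \<partial>lborel)"
    \<comment> \<open>The cut point 1/2 lies in neither open half, but it is a null set.\<close>
    by (rule nn_integral_cong_AE, rule AE_mp[OF AE_lborel_singleton[of "1/2"]])
       (auto split: split_indicator)
  also have "\<dots> = (\<integral>\<^sup>+u. f u * indicator {0<..<1/2} u \<partial>lborel) + (\<integral>\<^sup>+u. f u * indicator {1/2<..<1} u \<partial>lborel)"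
    by (rule nn_integral_add) auto
  also have "(\<integral>\<^sup>+u. f u * indicator {0<..<1/2} u \<partial>lborel) = ennreal (1/2) * (\<integral>\<^sup>+u. f (u / 2) * indicator {0<..<1} u \<partial>lborel)"
    by (subst nn_integral_real_affine[of _ "1/2" 0])
       (auto intro!: arg_cong2[where f="(*)"] nn_integral_cong split: split_indicator)
  also have "(\<integral>\<^sup>+u. f u * indicator {1/2<..<1} u \<partial>lborel) = ennreal (1/2) * (\<integral>\<^sup>+u. f ((u + 1) / 2) * indicator {0<..<1} u \<partial>lborel)"
    by (subst nn_integral_real_affine[of _ "1/2" "1/2"])
       (auto intro!: arg_cong2[where f="(*)"] nn_integral_cong simp: add_divide_distrib add.commute split: split_indicator)
  finally show ?thesis by (simp add: nn_integral_unit_uniform distrib_left)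
qed

definition half_left :: "nat \<Rightarrow> (nat \<Rightarrow> real) \<Rightarrow> nat \<Rightarrow> real" where
  "half_left i u = u(i := u i / 2)"

definition half_right :: "nat \<Rightarrow> (nat \<Rightarrow> real) \<Rightarrow> nat \<Rightarrow> real" where
  "half_right i u = u(i := (u i + 1) / 2)"

abbreviation open_cube :: "nat set \<Rightarrow> (nat \<Rightarrow> real) set" where
  "open_cube I \<equiv> PiE I (\<lambda>_. {0<..<1})"

lemma half_in_open_cube:
  assumes "i \<in> I" "u \<in> open_cube I"
  shows "half_left i u \<in> open_cube I" "half_right i u \<in> open_cube I"
proof -
  have "0 < u i" "u i < 1" using assms by auto
  then show "half_left i u \<in> open_cube I" "half_right i u \<in> open_cube I"
    using assms by (auto simp: half_left_def half_right_def PiE_def extensional_def Pi_def)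
qed

lemma half_funcset:
  assumes "i \<in> I" "h \<in> open_cube I \<rightarrow> Y"
  shows "(\<lambda>u. h (half_left i u)) \<in> open_cube I \<rightarrow> Y" "(\<lambda>u. h (half_right i u)) \<in> open_cube I \<rightarrow> Y"
  using assms(2) half_in_open_cube[OF assms(1)] by (simp_all add: Pi_iff del: PiE_iff)

lemma measurable_half:
  assumes "i \<in> I"
  shows "half_left i \<in> cube_uniform I \<rightarrow>\<^sub>M cube_uniform I" "half_right i \<in> cube_uniform I \<rightarrow>\<^sub>M cube_uniform I"
  unfolding half_left_def[abs_def] half_right_def[abs_def]
  using assms by (intro measurable_PiM_update; measurable)+

lemma nn_integral_cube_halve:
  assumes "finite I" "i \<in> I" and F[measurable]: "F \<in> borel_measurable (cube_uniform I)"
  shows "(\<integral>\<^sup>+u. F u \<partial>cube_uniform I) =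
    ennreal (1/2) * ((\<integral>\<^sup>+u. F (half_left i u) \<partial>cube_uniform I) + (\<integral>\<^sup>+u. F (half_right i u) \<partial>cube_uniform I))"
proof -
  note [measurable] = measurable_half[OF assms(2)]
  define J where "J = I - {i}"
  have I: "I = insert i J" "i \<notin> J" "finite J" using assms by (auto simp: J_def)
  have ins: "(\<integral>\<^sup>+u. H u \<partial>cube_uniform I) = (\<integral>\<^sup>+v. \<integral>\<^sup>+y. H (v(i := y)) \<partial>unit_uniform \<partial>cube_uniform J)"
    if "H \<in> borel_measurable (cube_uniform I)" for H
    using that I uniform_product.product_nn_integral_insert[of J i H] by simp
  have F': "F \<in> borel_measurable (cube_uniform (insert i J))" using F I by simp
  have Fi[measurable]: "(\<lambda>y. F (v(i := y))) \<in> borel_measurable borel" if "v \<in> space (cube_uniform J)" for v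
    using measurable_compose[OF measurable_component_update[OF that I(2)] F']
    by (simp cong: measurable_cong_sets)
  have upd: "(\<lambda>(v, y). v(i := y)) \<in> cube_uniform J \<Otimes>\<^sub>M unit_uniform \<rightarrow>\<^sub>M cube_uniform (insert i J)"
    by (rule measurable_add_dim)
  have FL: "(\<lambda>u. F (half_left i u)) \<in> borel_measurable (cube_uniform I)"
    and FR: "(\<lambda>u. F (half_right i u)) \<in> borel_measurable (cube_uniform I)" by measurable
  have sf: "sigma_finite_measure unit_uniform"
    by (simp add: prob_space_unit_uniform prob_space_imp_sigma_finite)
  have inner: "(\<lambda>v. \<integral>\<^sup>+y. H (v(i := y)) \<partial>unit_uniform) \<in> borel_measurable (cube_uniform J)"
    if "H \<in> borel_measurable (cube_uniform I)" for H
    using sigma_finite_measure.borel_measurable_nn_integral_fst[OF sf measurable_compose[OF upd that[unfolded I(1)]]] by simp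
  have "(\<integral>\<^sup>+u. F u \<partial>cube_uniform I) = (\<integral>\<^sup>+v. \<integral>\<^sup>+y. F (v(i := y)) \<partial>unit_uniform \<partial>cube_uniform J)"
    by (rule ins) fact
  also have "\<dots> = (\<integral>\<^sup>+v. ennreal (1/2) * ((\<integral>\<^sup>+y. F (half_left i (v(i := y))) \<partial>unit_uniform)
     + (\<integral>\<^sup>+y. F (half_right i (v(i := y))) \<partial>unit_uniform)) \<partial>cube_uniform J)"
    using Fi by (intro nn_integral_cong, subst nn_integral_unit_uniform_halve) (auto simp: half_left_def half_right_def)
  also have "\<dots> = ennreal (1/2) * ((\<integral>\<^sup>+v. \<integral>\<^sup>+y. F (half_left i (v(i := y))) \<partial>unit_uniform \<partial>cube_uniform J)
     + (\<integral>\<^sup>+v. \<integral>\<^sup>+y. F (half_right i (v(i := y))) \<partial>unit_uniform \<partial>cube_uniform J))"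
    using inner[OF FL] inner[OF FR] by (simp add: nn_integral_cmult nn_integral_add)
  also have "\<dots> = ennreal (1/2) * ((\<integral>\<^sup>+u. F (half_left i u) \<partial>cube_uniform I) + (\<integral>\<^sup>+u. F (half_right i u) \<partial>cube_uniform I))"
    by (simp only: ins[OF FL] ins[OF FR])
  finally show ?thesis .
qed

lemma AE_open_cube:
  assumes "finite I"
  shows "AE u in cube_uniform I. u \<in> open_cube I"
proof -
  have "AE x in unit_uniform. x \<in> {0<..<1}"
    unfolding unit_uniform_def by (subst AE_density) (auto split: split_indicator)
  then have "AE u in cube_uniform I. u i \<in> {0<..<1}" if "i \<in> I" for i
    using that by (intro AE_PiM_component prob_space_unit_uniform) auto
  then have "AE u in cube_uniform I. \<forall>i\<in>I. u i \<in> {0<..<1}"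
    using assms by (subst AE_finite_all) auto
  moreover have "AE u in cube_uniform I. u \<in> space (cube_uniform I)" by (rule AE_space)
  ultimately show ?thesis by eventually_elim (auto simp: space_PiM PiE_def)
qed

text \<open>The centre of the dyadic box that contains \<open>u\<close>; the list records the coordinates that are
  successively halved.\<close>

primrec grid_point :: "nat set \<Rightarrow> nat list \<Rightarrow> (nat \<Rightarrow> real) \<Rightarrow> nat \<Rightarrow> real" where
  "grid_point I [] u = (\<lambda>_\<in>I. 1/2)"
| "grid_point I (i # is) u =
     (if u i < 1/2 then half_left i (grid_point I is (u(i := 2 * u i)))
      else half_right i (grid_point I is (u(i := 2 * u i - 1))))"

lemma grid_point_in_cube: "set is \<subseteq> I \<Longrightarrow> grid_point I is u \<in> open_cube I"
proof (induction "is" arbitrary: u)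
  case (Cons i "is")
  then have "i \<in> I" "\<And>v. grid_point I is v \<in> open_cube I" by auto
  then show ?case by (simp add: half_in_open_cube del: PiE_iff)
qed auto

text \<open>The strict bound keeps the halved coordinate below 1/2, since \<open>grid_point\<close>
  assigns 1/2 itself to the right half; there a weak bound suffices.\<close>

lemma grid_point_half_left:
  assumes "u i < 1"
  shows "grid_point I (i # is) (half_left i u) = half_left i (grid_point I is u)"
proof -
  have "(half_left i u)(i := 2 * half_left i u i) = u" "half_left i u i < 1/2"
    using assms by (simp_all add: half_left_def)
  then show ?thesis by (simp only: grid_point.simps if_True)
qed

lemma grid_point_half_right:
  assumes "0 \<le> u i"
  shows "grid_point I (i # is) (half_right i u) = half_right i (grid_point I is u)"
proof -
  have "(half_right i u)(i := 2 * half_right i u i - 1) = u" "\<not> half_right i u i < 1/2"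
    using assms by (simp_all add: half_right_def add_divide_distrib)
  then show ?thesis by (simp only: grid_point.simps if_False)
qed

lemma measurable_grid_point: "set is \<subseteq> I \<Longrightarrow> grid_point I is \<in> cube_uniform I \<rightarrow>\<^sub>M cube_uniform I"
proof (induction "is")
  case Nil
  have "(\<lambda>_\<in>I. 1/2) \<in> space (cube_uniform I)" by (simp add: space_PiM)
  then show ?case unfolding grid_point.simps by (rule measurable_const)
next
  case (Cons i "is")
  then have i: "i \<in> I" and [measurable]: "grid_point I is \<in> cube_uniform I \<rightarrow>\<^sub>M cube_uniform I" by auto
  note [measurable] = measurable_half[OF i]
  have [measurable]: "(\<lambda>u. u(i := 2 * u i)) \<in> cube_uniform I \<rightarrow>\<^sub>M cube_uniform I"
    "(\<lambda>u. u(i := 2 * u i - 1)) \<in> cube_uniform I \<rightarrow>\<^sub>M cube_uniform I"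
    "(\<lambda>u. u i) \<in> borel_measurable (cube_uniform I)"
    using i by (auto intro!: measurable_PiM_update)
  show ?case by simp
qed

text \<open>The finer centre lies in the coarse box of \<open>u\<close> and never on its faces:
  rescaled centres belong to the open cube, so the halving rules apply at every level.\<close>

lemma grid_point_grid_point:
  assumes "set (is @ js) \<subseteq> I"
  shows "grid_point I is (grid_point I (is @ js) u) = grid_point I is u"
  using assms
proof (induction "is" arbitrary: u)
  case (Cons i "is")
  have "grid_point I (is @ js) v \<in> open_cube I" for v
    using Cons.prems by (intro grid_point_in_cube) auto
  then have "grid_point I (is @ js) v i < 1" "0 \<le> grid_point I (is @ js) v i" for v
    using Cons.prems by (auto simp: PiE_def Pi_def less_imp_le)
  then have "grid_point I (i # is) (half_left i (grid_point I (is @ js) v)) = half_left i (grid_point I is v)"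
    "grid_point I (i # is) (half_right i (grid_point I (is @ js) v)) = half_right i (grid_point I is v)" for v
    using Cons by (simp_all only: grid_point_half_left grid_point_half_right) auto
  then show ?case by (cases "u i < 1/2") (simp_all only: grid_point.simps append_Cons if_True if_False)
qed simp

text \<open>Only the list entries equal to \<open>i\<close> act on coordinate \<open>i\<close>, and
  each of them halves the error; cuts in other directions leave it unchanged.\<close>

lemma grid_point_error:
  assumes "set is \<subseteq> I" "i \<in> I" "0 \<le> u i" "u i \<le> 1"
  shows "\<bar>grid_point I is u i - u i\<bar> \<le> (1/2) ^ count_list is i"
  using assms
proof (induction "is" arbitrary: u)
  case (Cons j "is")
  show ?case
  proof (cases "j = i")
    case True
    define g where "g v = grid_point I is v i" for v
    have gp: "grid_point I (j # is) u i = (if u i < 1/2 then g (u(i := 2 * u i)) / 2 else (g (u(i := 2 * u i - 1)) + 1) / 2)"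
      using True by (simp add: half_left_def half_right_def g_def)
    have "\<bar>grid_point I (j # is) u i - u i\<bar> \<le> (1/2) ^ count_list is i / 2"
    proof (cases "u i < 1/2")
      case left: True
      have "\<bar>g (u(i := 2 * u i)) - 2 * u i\<bar> \<le> (1/2) ^ count_list is i"
        using Cons.IH[of "u(i := 2 * u i)", folded g_def] Cons.prems left by simp
      then show ?thesis using left gp by (simp only: if_True; linarith)
    next
      case right: False
      have "\<bar>g (u(i := 2 * u i - 1)) - (2 * u i - 1)\<bar> \<le> (1/2) ^ count_list is i"
        using Cons.IH[of "u(i := 2 * u i - 1)", folded g_def] Cons.prems right by simp
      moreover have eq: "grid_point I (j # is) u i - u i = (g (u(i := 2 * u i - 1)) - (2 * u i - 1)) / 2"
        using right gp by (simp only: if_False) (simp add: field_simps)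
      ultimately show ?thesis unfolding eq by simp
    qed
    then show ?thesis using True by (simp del: grid_point.simps)
  next
    case False
    define g where "g v = grid_point I is v i" for v
    have "\<bar>g (u(j := 2 * u j)) - u i\<bar> \<le> (1/2) ^ count_list is i"
      "\<bar>g (u(j := 2 * u j - 1)) - u i\<bar> \<le> (1/2) ^ count_list is i"
      using Cons.IH[of "u(j := 2 * u j)", folded g_def] Cons.IH[of "u(j := 2 * u j - 1)", folded g_def]
        Cons.prems False by simp_all
    then show ?thesis using False by (simp add: half_left_def half_right_def g_def)
  qed
qed (auto simp: abs_le_iff)

section \<open>Tournaments of midpoints over dyadic boxes\<close>

context midpoint_space
begin

text \<open>Precomposition rescales each half to the whole cube, so the recursion never handles
  sub-boxes. At the bottom the value at the centre of a box remains.\<close>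

primrec grid_barycenter :: "nat set \<Rightarrow> nat list \<Rightarrow> ((nat \<Rightarrow> real) \<Rightarrow> 'a) \<Rightarrow> 'a" where
  "grid_barycenter I [] h = h (\<lambda>_\<in>I. 1/2)"
| "grid_barycenter I (i # is) h =
     mid (grid_barycenter I is (\<lambda>u. h (half_left i u))) (grid_barycenter I is (\<lambda>u. h (half_right i u)))"

lemma grid_barycenter_in:
  "\<lbrakk>set is \<subseteq> I; h \<in> open_cube I \<rightarrow> Y\<rbrakk> \<Longrightarrow> grid_barycenter I is h \<in> Y"
proof (induction "is" arbitrary: h)
  case Nil
  have "(\<lambda>_\<in>I. 1/2) \<in> open_cube I" by auto
  then show ?case using Nil by auto
next
  case (Cons i "is")
  then have "i \<in> I" by simp
  then have "(\<lambda>u. h (half_left i u)) \<in> open_cube I \<rightarrow> Y" "(\<lambda>u. h (half_right i u)) \<in> open_cube I \<rightarrow> Y"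
    using Cons.prems(2) by (rule half_funcset)+
  then show ?case using Cons by (auto intro!: mid_in)
qed

text \<open>The tournament evaluates its map in the open cube only, which is where the halving rules
  of \<open>grid_point\<close> hold.\<close>

lemma grid_barycenter_cong:
  "\<lbrakk>set is \<subseteq> I; \<And>u. u \<in> open_cube I \<Longrightarrow> h u = h' u\<rbrakk> \<Longrightarrow> grid_barycenter I is h = grid_barycenter I is h'"
proof (induction "is" arbitrary: h h')
  case Nil
  have "(\<lambda>_\<in>I. 1/2) \<in> open_cube I" by auto
  then show ?case using Nil by auto
next
  case (Cons i "is")
  have "grid_barycenter I is (\<lambda>u. h (half_left i u)) = grid_barycenter I is (\<lambda>u. h' (half_left i u))"
    "grid_barycenter I is (\<lambda>u. h (half_right i u)) = grid_barycenter I is (\<lambda>u. h' (half_right i u))"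
    using Cons.prems half_in_open_cube by (intro Cons.IH; force)+
  then show ?case by simp
qed

lemma grid_barycenter_const: "y \<in> Y \<Longrightarrow> grid_barycenter I is (\<lambda>_. y) = y"
  by (induction "is") (auto simp: mid_idem)

text \<open>Inside a coarse box the map is constant, so the extra rounds \<open>js\<close> take
  midpoints of equal points.\<close>

lemma grid_barycenter_refine:
  "\<lbrakk>set (is @ js) \<subseteq> I; h \<in> open_cube I \<rightarrow> Y\<rbrakk> \<Longrightarrow>
    grid_barycenter I (is @ js) (\<lambda>u. h (grid_point I is u)) = grid_barycenter I is h"
proof (induction "is" arbitrary: h)
  case Nil
  have "(\<lambda>_\<in>I. 1/2) \<in> open_cube I" by auto
  then have "h (\<lambda>_\<in>I. 1/2) \<in> Y" using Nil by blast
  then show ?case by (simp only: grid_point.simps append_Nil grid_barycenter_const grid_barycenter.simps)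
next
  case (Cons i "is")
  have i: "i \<in> I" "set (is @ js) \<subseteq> I" using Cons.prems by auto
  have u: "u i < 1" "0 \<le> u i" if "u \<in> open_cube I" for u
    using that i(1) by (auto simp: PiE_def Pi_def less_imp_le)
  have h: "(\<lambda>u. h (half_left i u)) \<in> open_cube I \<rightarrow> Y" "(\<lambda>u. h (half_right i u)) \<in> open_cube I \<rightarrow> Y"
    using half_funcset[OF i(1) Cons.prems(2)] .
  have "grid_barycenter I (is @ js) (\<lambda>u. h (grid_point I (i # is) (half_left i u)))
    = grid_barycenter I (is @ js) (\<lambda>u. h (half_left i (grid_point I is u)))"
    using u i by (intro grid_barycenter_cong) (auto simp only: grid_point_half_left)
  also have "\<dots> = grid_barycenter I is (\<lambda>u. h (half_left i u))"
    by (rule Cons.IH[OF i(2) h(1)])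
  finally have L: "grid_barycenter I (is @ js) (\<lambda>u. h (grid_point I (i # is) (half_left i u)))
    = grid_barycenter I is (\<lambda>u. h (half_left i u))" .
  have "grid_barycenter I (is @ js) (\<lambda>u. h (grid_point I (i # is) (half_right i u)))
    = grid_barycenter I (is @ js) (\<lambda>u. h (half_right i (grid_point I is u)))"
    using u i by (intro grid_barycenter_cong) (auto simp only: grid_point_half_right)
  also have "\<dots> = grid_barycenter I is (\<lambda>u. h (half_right i u))"
    by (rule Cons.IH[OF i(2) h(2)])
  finally show ?case using L by (simp only: append_Cons grid_barycenter.simps)
qed

text \<open>Each midpoint averages two distances, and \<open>nn_integral_cube_halve\<close> averages
  the integrals alike. The integral of the step function replaces a finite sum over boxes, which
  suits later limits. The measurable majorant \<open>\<psi>\<close> stands for the distance because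
  \<open>h\<close> and \<open>h'\<close> carry no measurability assumption.\<close>

lemma dist_grid_barycenter_le:
  assumes I: "finite I"
  shows "\<lbrakk>set is \<subseteq> I; h \<in> open_cube I \<rightarrow> Y; h' \<in> open_cube I \<rightarrow> Y; \<psi> \<in> borel_measurable (cube_uniform I);
      \<And>u. u \<in> open_cube I \<Longrightarrow> ennreal (dist (h u) (h' u)) \<le> \<psi> u\<rbrakk> \<Longrightarrow>
    ennreal (dist (grid_barycenter I is h) (grid_barycenter I is h')) \<le> (\<integral>\<^sup>+u. \<psi> (grid_point I is u) \<partial>cube_uniform I)"
proof (induction "is" arbitrary: h h' \<psi>)
  case Nil
  interpret prob_space "cube_uniform I" by (rule prob_space_cube_uniform)
  have "(\<lambda>_\<in>I. 1/2) \<in> open_cube I" by auto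
  then show ?case using Nil(5) by (simp add: emeasure_space_1 del: restrict_apply)
next
  case (Cons i "is")
  have i: "i \<in> I" "set is \<subseteq> I" using Cons.prems by auto
  note [measurable] = Cons.prems(4) measurable_half[OF i(1)] measurable_grid_point[OF i(2)] measurable_grid_point[OF Cons.prems(1)]
  have hs: "(\<lambda>u. h (half_left i u)) \<in> open_cube I \<rightarrow> Y" "(\<lambda>u. h (half_right i u)) \<in> open_cube I \<rightarrow> Y"
    "(\<lambda>u. h' (half_left i u)) \<in> open_cube I \<rightarrow> Y" "(\<lambda>u. h' (half_right i u)) \<in> open_cube I \<rightarrow> Y"
    using half_funcset[OF i(1) Cons.prems(2)] half_funcset[OF i(1) Cons.prems(3)] .
  have L: "ennreal (dist (grid_barycenter I is (\<lambda>u. h (half_left i u))) (grid_barycenter I is (\<lambda>u. h' (half_left i u))))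
    \<le> (\<integral>\<^sup>+u. \<psi> (half_left i (grid_point I is u)) \<partial>cube_uniform I)"
    by (rule Cons.IH[OF i(2) hs(1,3)]) (measurable, intro Cons.prems(5) half_in_open_cube i)
  have R: "ennreal (dist (grid_barycenter I is (\<lambda>u. h (half_right i u))) (grid_barycenter I is (\<lambda>u. h' (half_right i u))))
    \<le> (\<integral>\<^sup>+u. \<psi> (half_right i (grid_point I is u)) \<partial>cube_uniform I)"
    by (rule Cons.IH[OF i(2) hs(2,4)]) (measurable, intro Cons.prems(5) half_in_open_cube i)
  have "dist (grid_barycenter I (i # is) h) (grid_barycenter I (i # is) h')
    \<le> (dist (grid_barycenter I is (\<lambda>u. h (half_left i u))) (grid_barycenter I is (\<lambda>u. h' (half_left i u)))
     + dist (grid_barycenter I is (\<lambda>u. h (half_right i u))) (grid_barycenter I is (\<lambda>u. h' (half_right i u)))) / 2"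
    unfolding grid_barycenter.simps by (intro dist_mid_le grid_barycenter_in i hs)
  then have "ennreal (dist (grid_barycenter I (i # is) h) (grid_barycenter I (i # is) h'))
    \<le> ennreal (1/2 * (dist (grid_barycenter I is (\<lambda>u. h (half_left i u))) (grid_barycenter I is (\<lambda>u. h' (half_left i u)))
     + dist (grid_barycenter I is (\<lambda>u. h (half_right i u))) (grid_barycenter I is (\<lambda>u. h' (half_right i u)))))"
    by (intro ennreal_leI) simp
  also have "\<dots> = ennreal (1/2) * (ennreal (dist (grid_barycenter I is (\<lambda>u. h (half_left i u))) (grid_barycenter I is (\<lambda>u. h' (half_left i u))))
     + ennreal (dist (grid_barycenter I is (\<lambda>u. h (half_right i u))) (grid_barycenter I is (\<lambda>u. h' (half_right i u)))))"
    by (subst ennreal_mult) (auto simp: ennreal_plus)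
  also have "\<dots> \<le> ennreal (1/2) * ((\<integral>\<^sup>+u. \<psi> (half_left i (grid_point I is u)) \<partial>cube_uniform I)
     + (\<integral>\<^sup>+u. \<psi> (half_right i (grid_point I is u)) \<partial>cube_uniform I))"
    by (intro mult_left_mono add_mono L R) auto
  also have "(\<integral>\<^sup>+u. \<psi> (half_left i (grid_point I is u)) \<partial>cube_uniform I)
    = (\<integral>\<^sup>+u. \<psi> (grid_point I (i # is) (half_left i u)) \<partial>cube_uniform I)"
  proof (rule nn_integral_cong_AE)
    \<comment> \<open>The halving rules are available inside the open cube, which has full
      measure.\<close>
    show "AE u in cube_uniform I. \<psi> (half_left i (grid_point I is u)) = \<psi> (grid_point I (i # is) (half_left i u))"
      using AE_open_cube[OF I]
    proof eventually_elim
      case (elim u)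
      then have "0 < u i" "u i < 1" using i(1) by auto
      then show ?case by (simp only: grid_point_half_left less_imp_le)
    qed
  qed
  also have "(\<integral>\<^sup>+u. \<psi> (half_right i (grid_point I is u)) \<partial>cube_uniform I)
    = (\<integral>\<^sup>+u. \<psi> (grid_point I (i # is) (half_right i u)) \<partial>cube_uniform I)"
  proof (rule nn_integral_cong_AE)
    show "AE u in cube_uniform I. \<psi> (half_right i (grid_point I is u)) = \<psi> (grid_point I (i # is) (half_right i u))"
      using AE_open_cube[OF I]
    proof eventually_elim
      case (elim u)
      then have "0 < u i" "u i < 1" using i(1) by auto
      then show ?case by (simp only: grid_point_half_right less_imp_le)
    qed
  qed
  also have "ennreal (1/2) * ((\<integral>\<^sup>+u. \<psi> (grid_point I (i # is) (half_left i u)) \<partial>cube_uniform I)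
      + (\<integral>\<^sup>+u. \<psi> (grid_point I (i # is) (half_right i u)) \<partial>cube_uniform I))
    = (\<integral>\<^sup>+u. \<psi> (grid_point I (i # is) u) \<partial>cube_uniform I)"
    using I i(1) by (intro nn_integral_cube_halve[symmetric]) (auto simp del: grid_point.simps)
  finally show ?case .
qed

end

section \<open>Convergence of the tournaments to a barycenter\<close>

lemma edist_triangle: "edist k x z \<le> edist k x y + edist k y z"
proof -
  have "L2_set (\<lambda>i. (x i - y i) + (y i - z i)) {..<k} \<le> edist k x y + edist k y z"
    unfolding edist_def by (rule L2_set_triangle_ineq)
  then show ?thesis by (simp add: edist_def)
qed

lemma edist_commute: "edist k x y = edist k y x"
  unfolding edist_def L2_set_def by (simp add: power2_commute)

text \<open>All coordinates are halved in turn, so \<open>k\<close> rounds give cubes of side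
  \<open>1 / 2 ^ k\<close>. The fixed order makes level \<open>k\<close> a prefix of level
  \<open>k + j\<close>, as refinement demands.\<close>

definition coord_cycle :: "nat \<Rightarrow> nat \<Rightarrow> nat list" where
  "coord_cycle N k = concat (replicate k [0..<N])"

lemma coord_cycle_add: "coord_cycle N (k + j) = coord_cycle N k @ coord_cycle N j"
  by (simp add: coord_cycle_def replicate_add)

lemma set_coord_cycle: "set (coord_cycle N k) \<subseteq> {..<N}"
  by (auto simp: coord_cycle_def)

lemma count_coord_cycle: "i < N \<Longrightarrow> count_list (coord_cycle N k) i = k"
proof (induction k)
  case (Suc k)
  have "count_list [0..<N] i = 1"
    using Suc.prems by (simp add: count_list_eq_length_filter distinct_length_filter flip: count_mset)
  then show ?case using Suc by (simp add: coord_cycle_def)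
qed (simp add: coord_cycle_def)

lemma grid_point_tendsto:
  assumes "u \<in> open_cube {..<N}" "i < N"
  shows "(\<lambda>k. grid_point {..<N} (coord_cycle N k) u i) \<longlonglongrightarrow> u i"
proof -
  have u: "0 \<le> u i" "u i \<le> 1" using assms by (auto simp: PiE_def Pi_def less_imp_le)
  have "(\<lambda>k. grid_point {..<N} (coord_cycle N k) u i - u i) \<longlonglongrightarrow> 0"
  proof (rule Lim_null_comparison)
    show "\<forall>\<^sub>F k in sequentially. norm (grid_point {..<N} (coord_cycle N k) u i - u i) \<le> (1/2) ^ k"
      using grid_point_error[OF set_coord_cycle, of i N u] assms u by (simp add: count_coord_cycle)
  qed (auto intro: LIMSEQ_power_zero)
  then show ?thesis by (simp add: LIM_zero_iff)
qed

text \<open>The map \<open>g\<close> into Euclidean space controls \<open>h\<close>, so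
  measurability, domination by \<open>C\<close> and convergence are all tested on \<open>g\<close>.
  The tournaments are Cauchy because the mean distance \<open>D l\<close> between \<open>g\<close>
  and its step approximation tends to 0.\<close>

lemma (in midpoint_space) ex_barycenter:
  fixes g :: "(nat \<Rightarrow> real) \<Rightarrow> nat \<Rightarrow> real"
  assumes "complete Y" and h: "h \<in> open_cube {..<N} \<rightarrow> Y" and L: "0 \<le> L"
    and meas: "\<And>i. i < k \<Longrightarrow> (\<lambda>u. g u i) \<in> borel_measurable (cube_uniform {..<N})"
    and bound: "\<And>u v. edist k (g u) (g v) \<le> C"
    and hL: "\<And>u v. \<lbrakk>u \<in> open_cube {..<N}; v \<in> open_cube {..<N}\<rbrakk> \<Longrightarrow> dist (h u) (h v) \<le> L * edist k (g u) (g v)"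
    and lim: "\<And>i. i < k \<Longrightarrow> AE u in cube_uniform {..<N}. (\<lambda>l. g (grid_point {..<N} (coord_cycle N l) u) i) \<longlonglongrightarrow> g u i"
  obtains b where "b \<in> Y"
    "\<And>y q. \<lbrakk>y \<in> Y; \<And>u. u \<in> open_cube {..<N} \<Longrightarrow> dist (h u) y \<le> L * edist k (g u) q\<rbrakk> \<Longrightarrow>
      ennreal (dist b y) \<le> ennreal L * (\<integral>\<^sup>+u. ennreal (edist k (g u) q) \<partial>cube_uniform {..<N})"
proof -
  define I where "I = {..<N}"
  have fin: "finite I" by (simp add: I_def)
  note gp = set_coord_cycle[of N, folded I_def]
  define P where "P l = grid_point I (coord_cycle N l)" for l
  interpret prob_space "cube_uniform I" by (rule prob_space_cube_uniform)
  have P[measurable]: "P l \<in> cube_uniform I \<rightarrow>\<^sub>M cube_uniform I" for l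
    unfolding P_def by (rule measurable_grid_point[OF gp])
  have ed: "(\<lambda>u. edist k (\<lambda>i. a u i) (\<lambda>i. b u i)) \<in> borel_measurable (cube_uniform I)"
    if "\<And>i. i < k \<Longrightarrow> (\<lambda>u. a u i) \<in> borel_measurable (cube_uniform I)"
       "\<And>i. i < k \<Longrightarrow> (\<lambda>u. b u i) \<in> borel_measurable (cube_uniform I)" for a b :: "(nat \<Rightarrow> real) \<Rightarrow> nat \<Rightarrow> real"
  proof -
    have [measurable]: "(\<lambda>u. \<Sum>i<k. (a u i - b u i)\<^sup>2) \<in> borel_measurable (cube_uniform I)"
      by (intro borel_measurable_sum borel_measurable_power borel_measurable_diff that) auto
    show ?thesis unfolding edist_eq_sqnorm sqnorm_def by measurable
  qed
  have gP: "(\<lambda>u. g (P l u) i) \<in> borel_measurable (cube_uniform I)" if "i < k" for l i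
    using measurable_compose[OF P meas[OF that, folded I_def]] .
  note gm = meas[folded I_def]
  have edPg[measurable]: "(\<lambda>u. edist k (g (P l u)) (g u)) \<in> borel_measurable (cube_uniform I)" for l
    by (rule ed) (use gP gm in auto)
  have edg[measurable]: "(\<lambda>u. edist k (g u) q) \<in> borel_measurable (cube_uniform I)" for q
    by (rule ed) (use gm in auto)
  define D where "D l = (\<integral>u. edist k (g (P l u)) (g u) \<partial>cube_uniform I)" for l
  have int: "integrable (cube_uniform I) (\<lambda>u. edist k (g (P l u)) (g u))" for l
    by (rule integrable_const_bound[where B=C]) (use bound edist_nonneg in auto)
  have D_nn: "(\<integral>\<^sup>+u. ennreal (edist k (g (P l u)) (g u)) \<partial>cube_uniform I) = ennreal (D l)" for l
    unfolding D_def by (rule nn_integral_eq_integral[OF int]) (simp add: edist_nonneg)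
  have D0: "0 \<le> D l" for l unfolding D_def by (intro integral_nonneg_AE) (simp add: edist_nonneg)
  have Dlim: "D \<longlonglongrightarrow> 0"
  proof -
    have "(\<lambda>l. \<integral>u. edist k (g (P l u)) (g u) \<partial>cube_uniform I) \<longlonglongrightarrow> (\<integral>u. 0 \<partial>cube_uniform I)"
    proof (rule integral_dominated_convergence[where w="\<lambda>_. C"])
      have "AE u in cube_uniform I. (\<lambda>l. g (P l u) i) \<longlonglongrightarrow> g u i" if "i < k" for i
        using lim[OF that] unfolding I_def P_def .
      then have "AE u in cube_uniform I. \<forall>i\<in>{..<k}. (\<lambda>l. g (P l u) i) \<longlonglongrightarrow> g u i"
        by (subst AE_finite_all) auto
      then show "AE u in cube_uniform I. (\<lambda>l. edist k (g (P l u)) (g u)) \<longlonglongrightarrow> 0"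
      proof eventually_elim
        case (elim u)
        have "(\<lambda>l. edist k (g (P l u)) (g u)) \<longlonglongrightarrow> sqrt (\<Sum>i<k. (g u i - g u i)\<^sup>2)"
          unfolding edist_eq_sqnorm sqnorm_def using elim by (intro tendsto_intros) auto
        then show ?case by simp
      qed
      show "AE u in cube_uniform I. norm (edist k (g (P l u)) (g u)) \<le> C" for l
        using bound edist_nonneg by simp
    qed auto
    then show ?thesis by (simp add: D_def[abs_def])
  qed
  define b where "b l = grid_barycenter I (coord_cycle N l) h" for l
  have h': "h \<in> open_cube I \<rightarrow> Y" using h by (simp add: I_def)
  have bY: "b l \<in> Y" for l unfolding b_def by (rule grid_barycenter_in[OF gp h'])
  have Pc: "P l u \<in> open_cube I" for l u unfolding P_def by (rule grid_point_in_cube[OF gp])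
  \<comment> \<open>Refinement lifts the coarse tournament to level \<open>l + j\<close>; there the
    two tournaments differ by at most a mean distance of their maps.\<close>
  have bb: "dist (b l) (b (l + j)) \<le> L * (D l + D (l + j))" for l j
  proof -
    have sub: "set (coord_cycle N l @ coord_cycle N j) \<subseteq> I" using gp by simp
    have hP: "(\<lambda>u. h (P l u)) \<in> open_cube I \<rightarrow> Y" using h' Pc by blast
    have "b l = grid_barycenter I (coord_cycle N (l + j)) (\<lambda>u. h (P l u))"
      unfolding b_def P_def coord_cycle_add by (rule grid_barycenter_refine[OF sub h', symmetric])
    moreover have "ennreal (dist (grid_barycenter I (coord_cycle N (l + j)) (\<lambda>u. h (P l u))) (b (l + j)))
      \<le> (\<integral>\<^sup>+u. ennreal (L * edist k (g (P l (P (l + j) u))) (g (P (l + j) u))) \<partial>cube_uniform I)"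
      unfolding b_def P_def[of "l + j"]
    proof (rule dist_grid_barycenter_le[OF fin gp hP h'])
      show "(\<lambda>u. ennreal (L * edist k (g (P l u)) (g u))) \<in> borel_measurable (cube_uniform I)" by measurable
      show "ennreal (dist (h (P l u)) (h u)) \<le> ennreal (L * edist k (g (P l u)) (g u))" if "u \<in> open_cube I" for u
        using that Pc by (intro ennreal_leI hL[folded I_def])
    qed
    ultimately have "ennreal (dist (b l) (b (l + j)))
      \<le> (\<integral>\<^sup>+u. ennreal (L * edist k (g (P l (P (l + j) u))) (g (P (l + j) u))) \<partial>cube_uniform I)"
      by simp
    also have "\<dots> \<le> (\<integral>\<^sup>+u. ennreal L * (ennreal (edist k (g (P l u)) (g u)) + ennreal (edist k (g (P (l + j) u)) (g u))) \<partial>cube_uniform I)"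
    proof (rule nn_integral_mono)
      fix u
      \<comment> \<open>Snapping to the fine and then to the coarse grid equals snapping to the
        coarse one, so the integrand compares two step approximations of \<open>g\<close> at the
        same \<open>u\<close>.\<close>
      have "P l (P (l + j) u) = P l u"
        unfolding P_def coord_cycle_add by (rule grid_point_grid_point[OF sub])
      moreover have "edist k (g (P l u)) (g (P (l + j) u)) \<le> edist k (g (P l u)) (g u) + edist k (g (P (l + j) u)) (g u)"
        using edist_triangle edist_commute by metis
      ultimately show "ennreal (L * edist k (g (P l (P (l + j) u))) (g (P (l + j) u)))
        \<le> ennreal L * (ennreal (edist k (g (P l u)) (g u)) + ennreal (edist k (g (P (l + j) u)) (g u)))"
        using L edist_nonneg by (simp add: mult_left_mono flip: ennreal_plus ennreal_mult)
    qed
    also have "\<dots> = ennreal L * (ennreal (D l) + ennreal (D (l + j)))"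
      by (simp add: nn_integral_cmult nn_integral_add D_nn)
    also have "\<dots> = ennreal (L * (D l + D (l + j)))" using L D0 by (simp flip: ennreal_plus ennreal_mult)
    finally show ?thesis using L D0 by (simp add: ennreal_le_iff)
  qed
  have "Cauchy b"
  proof (rule CauchyI')
    fix e :: real assume e: "0 < e"
    have "(\<lambda>l. L * D l) \<longlonglongrightarrow> 0" using tendsto_mult_right_zero[OF Dlim] .
    then obtain K where K: "\<And>l. l \<ge> K \<Longrightarrow> L * D l < e / 2"
      using order_tendstoD(2)[of _ 0 sequentially "e/2"] e unfolding eventually_sequentially by force
    show "\<exists>K. \<forall>m\<ge>K. \<forall>n>m. dist (b m) (b n) < e"
    proof (intro exI allI impI)
      fix m n assume mn: "K \<le> m" "m < n"
      have "dist (b m) (b (m + (n - m))) \<le> L * (D m + D (m + (n - m)))" by (rule bb)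
      then show "dist (b m) (b n) < e" using K[of m] K[of n] mn by (simp add: distrib_left)
    qed
  qed
  then obtain c where c: "c \<in> Y" "b \<longlonglongrightarrow> c" using \<open>complete Y\<close> bY completeE by metis
  show ?thesis
  proof (rule that[OF c(1)])
    fix y q assume y: "y \<in> Y" and yq: "\<And>u. u \<in> open_cube {..<N} \<Longrightarrow> dist (h u) y \<le> L * edist k (g u) q"
    define E where "E = (\<integral>\<^sup>+u. ennreal (edist k (g u) q) \<partial>cube_uniform I)"
    \<comment> \<open>The opponent is the tournament of the constant map \<open>y\<close>, which is
      \<open>y\<close> itself; this is Jensen's inequality up to the error
      \<open>D l\<close>.\<close>
    have le: "ennreal (dist (b l) y) \<le> ennreal L * (ennreal (D l) + E)" for l
    proof -
      have "ennreal (dist (b l) (grid_barycenter I (coord_cycle N l) (\<lambda>_. y)))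
        \<le> (\<integral>\<^sup>+u. ennreal (L * edist k (g (P l u)) q) \<partial>cube_uniform I)"
        unfolding b_def P_def
      proof (rule dist_grid_barycenter_le[OF fin gp h'])
        show "(\<lambda>u. ennreal (L * edist k (g u) q)) \<in> borel_measurable (cube_uniform I)" by measurable
        show "ennreal (dist (h u) y) \<le> ennreal (L * edist k (g u) q)" if "u \<in> open_cube I" for u
          using that by (intro ennreal_leI yq[folded I_def])
      qed (use y in simp)
      also have "\<dots> \<le> (\<integral>\<^sup>+u. ennreal L * (ennreal (edist k (g (P l u)) (g u)) + ennreal (edist k (g u) q)) \<partial>cube_uniform I)"
        using L edist_nonneg edist_triangle
        by (intro nn_integral_mono) (simp add: mult_left_mono flip: ennreal_plus ennreal_mult)
      also have "\<dots> = ennreal L * (ennreal (D l) + E)"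
        by (simp add: nn_integral_cmult nn_integral_add D_nn E_def)
      finally show ?thesis using y by (simp add: grid_barycenter_const)
    qed
    have "ennreal (dist c y) \<le> ennreal L * (ennreal 0 + E)"
    proof (rule LIMSEQ_le)
      show "(\<lambda>l. ennreal (dist (b l) y)) \<longlonglongrightarrow> ennreal (dist c y)"
        by (intro tendsto_intros c)
      show "(\<lambda>l. ennreal L * (ennreal (D l) + E)) \<longlonglongrightarrow> ennreal L * (ennreal 0 + E)"
        by (intro tendsto_intros ennreal_tendsto_cmult Dlim) simp
    qed (use le in blast)
    then show "ennreal (dist c y) \<le> ennreal L * (\<integral>\<^sup>+u. ennreal (edist k (g u) q) \<partial>cube_uniform {..<N})"
      by (simp add: E_def I_def)
  qed
qed

section \<open>Polar coordinates on the sphere\<close>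

text \<open>The matrix determinant lemma. The blocks are chosen so that \<open>X * Z\<close> and
  \<open>Z * X\<close> are both block upper triangular, with diagonals \<open>A\<close>, 1 and
  identity, \<open>b * a + 1\<close>; their determinants agree.\<close>

lemma det_id_plus_rank_one:
  fixes u :: "nat \<Rightarrow> real"
  shows "Determinant.det (mat n n (\<lambda>(i, j). (if i = j then 1 else 0) + c * u i * u j)) = 1 + c * sqnorm n u"
proof -
  define a where "a = mat n 1 (\<lambda>(i, _). c * u i)"
  define b where "b = mat 1 n (\<lambda>(_, j). u j)"
  define A where "A = mat n n (\<lambda>(i, j). (if i = j then 1 else 0) + c * u i * u j)"
  define X where "X = four_block_mat (1\<^sub>m n) a (- b) (1\<^sub>m 1)"
  define Z where "Z = four_block_mat (1\<^sub>m n) (0\<^sub>m n 1) b (1\<^sub>m 1)"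
  have XZ_carrier: "X \<in> carrier_mat (n + 1) (n + 1)" "Z \<in> carrier_mat (n + 1) (n + 1)"
    and [simp]: "A \<in> carrier_mat n n"
    by (auto simp: A_def X_def Z_def)
  have [simp]: "a \<in> carrier_mat n (Suc 0)" "b \<in> carrier_mat (Suc 0) n"
    by (simp_all add: a_def b_def)
  have [simp]: "0\<^sub>m n (Suc 0) + a * 1\<^sub>m (Suc 0) = a" "1\<^sub>m (Suc 0) * b = b" "b * 1\<^sub>m n = b"
    "1\<^sub>m n * a = a" "a + 0\<^sub>m n (Suc 0) = a"
    by (simp_all add: a_def b_def)
  have [simp]: "1\<^sub>m n + 0\<^sub>m n (Suc 0) * - b = 1\<^sub>m n" "- b + b = 0\<^sub>m (Suc 0) n" "b + - b = 0\<^sub>m (Suc 0) n" "- b * 1\<^sub>m n = - b"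
    "1\<^sub>m (Suc 0) * - b = - b" "- b * 0\<^sub>m n (Suc 0) = 0\<^sub>m (Suc 0) (Suc 0)"
    by (simp_all add: b_def, auto intro!: eq_matI)
  have A: "1\<^sub>m n + a * b = A"
    by (rule eq_matI) (auto simp: a_def b_def A_def scalar_prod_def)
  have ba: "b * a + 1\<^sub>m 1 = mat 1 1 (\<lambda>_. 1 + c * sqnorm n u)"
    by (rule eq_matI)
      (auto simp: a_def b_def scalar_prod_def sqnorm_def sum_distrib_left power2_eq_square mult_ac lessThan_atLeast0)
  have XZ: "X * Z = four_block_mat A a (0\<^sub>m 1 n) (1\<^sub>m 1)"
    unfolding X_def Z_def A[symmetric]
    by (subst mult_four_block_mat[of _ n n _ 1 _ 1 _ _ n _ 1]) auto
  have ZX: "Z * X = four_block_mat (1\<^sub>m n) a (0\<^sub>m 1 n) (b * a + 1\<^sub>m 1)"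
    unfolding X_def Z_def
    by (subst mult_four_block_mat[of _ n n _ 1 _ 1 _ _ n _ 1]) auto
  have "Determinant.det (X * Z) = Determinant.det (Z * X)"
    using det_mult[of X "n + 1" Z] det_mult[of Z "n + 1" X] XZ_carrier by simp
  then have "Determinant.det A * Determinant.det (1\<^sub>m 1 :: real mat)
    = Determinant.det (1\<^sub>m n :: real mat) * Determinant.det (b * a + 1\<^sub>m 1)"
    unfolding XZ ZX
    by (subst (asm) (1 2) det_four_block_mat_lower_left_zero) auto
  then show ?thesis unfolding ba A_def by (simp add: det_single)
qed

lemma deriv_hemisphere_param:
  assumes "i < n" "sqnorm n u < 1"
  shows "k < n \<Longrightarrow> deriv (\<lambda>t. hemisphere_param n s (u(i := t)) k) (u i) = (if k = i then 1 else 0)"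
    and "deriv (\<lambda>t. hemisphere_param n s (u(i := t)) n) (u i) = - s * u i / sqrt (1 - sqnorm n u)"
proof -
  assume k: "k < n"
  then have "(\<lambda>t. hemisphere_param n s (u(i := t)) k) = (\<lambda>t. if k = i then t else u k)"
    by (auto simp: hemisphere_param_def)
  then show "deriv (\<lambda>t. hemisphere_param n s (u(i := t)) k) (u i) = (if k = i then 1 else 0)" by simp
next
  have sq: "sqnorm n (u(i := t)) = t\<^sup>2 + (\<Sum>j\<in>{..<n} - {i}. (u j)\<^sup>2)" for t
    unfolding sqnorm_def using assms(1) by (subst sum.remove[of _ i]) (auto intro!: sum.cong)
  define R where "R = (\<Sum>j\<in>{..<n} - {i}. (u j)\<^sup>2)"
  have pos: "1 - ((u i)\<^sup>2 + R) = 1 - sqnorm n u" using sq[of "u i"] by (simp add: R_def)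
  have "((\<lambda>t. s * sqrt (1 - (t\<^sup>2 + R))) has_real_derivative - s * u i / sqrt (1 - sqnorm n u)) (at (u i))"
    by (rule derivative_eq_intros refl | use pos assms in \<open>simp add: field_simps\<close>)+
  moreover have "(\<lambda>t. hemisphere_param n s (u(i := t)) n) = (\<lambda>t. s * sqrt (1 - (t\<^sup>2 + R)))"
    unfolding hemisphere_param_def sqnorm_def[symmetric] sq R_def by simp
  ultimately show "deriv (\<lambda>t. hemisphere_param n s (u(i := t)) n) (u i) = - s * u i / sqrt (1 - sqnorm n u)"
    by (simp add: DERIV_imp_deriv)
qed

text \<open>The metric of a graph is the identity plus the gradient times its transpose. Here the
  gradient is \<open>- s * u / sqrt (1 - sqnorm n u)\<close>, a rank one perturbation.\<close>

lemma sqrt_det_hemisphere: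
  assumes "sqnorm n u < 1" "s\<^sup>2 = 1"
  shows "sqrt (Determinant.det (pullback_metric n (hemisphere_param n s) u)) = 1 / sqrt (1 - sqnorm n u)"
proof -
  define c where "c = 1 / (1 - sqnorm n u)"
  have "pullback_metric n (hemisphere_param n s) u
    = mat n n (\<lambda>(i, j). (if i = j then 1 else 0) + c * u i * u j)"
    unfolding pullback_metric_def
  proof (rule cong_mat[OF refl refl], unfold prod.case)
    fix i j assume ij: "i < n" "j < n"
    have "(\<Sum>k\<le>n. deriv (\<lambda>t. hemisphere_param n s (u(i := t)) k) (u i) *
                deriv (\<lambda>t. hemisphere_param n s (u(j := t)) k) (u j)) =
      (\<Sum>k<n. (if k = i then 1 else 0) * (if k = j then 1 else 0)) +
        (- s * u i / sqrt (1 - sqnorm n u)) * (- s * u j / sqrt (1 - sqnorm n u))"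
      using ij assms(1) by (simp add: lessThan_Suc_atMost[symmetric] deriv_hemisphere_param)
    also have "(\<Sum>k<n. (if k = i then 1 else 0) * (if k = j then 1 else 0 :: real)) = (if i = j then 1 else 0)"
    proof -
      have "(\<Sum>k<n. (if k = i then 1 else 0) * (if k = j then 1 else 0 :: real))
        = (\<Sum>k<n. if k = i then (if i = j then 1 else 0) else 0)" by (intro sum.cong) auto
      then show ?thesis using ij by simp
    qed
    also have "(- s * u i / sqrt (1 - sqnorm n u)) * (- s * u j / sqrt (1 - sqnorm n u)) = s\<^sup>2 * u i * u j / (1 - sqnorm n u)"
      using assms(1) by (simp add: power2_eq_square)
    also have "\<dots> = c * u i * u j" using assms(2) by (simp add: c_def)
    finally show "(\<Sum>k\<le>n. deriv (\<lambda>t. hemisphere_param n s (u(i := t)) k) (u i) *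
                deriv (\<lambda>t. hemisphere_param n s (u(j := t)) k) (u j)) = (if i = j then 1 else 0) + c * u i * u j" .
  qed
  then have "Determinant.det (pullback_metric n (hemisphere_param n s) u) = 1 + c * sqnorm n u"
    by (simp add: det_id_plus_rank_one)
  also have "\<dots> = 1 / (1 - sqnorm n u)" using assms(1) by (simp add: c_def field_simps)
  finally show ?thesis by (simp add: real_sqrt_divide)
qed

lemma measurable_hemisphere_param: "hemisphere_param n s \<in> coord_lborel {..<n} \<rightarrow>\<^sub>M borel"
proof (rule measurable_coordinatewise_then_product)
  note measurable_sqnorm[measurable]
  have [measurable]: "(\<lambda>u. s * sqrt (1 - (\<Sum>j<n. (u j)\<^sup>2))) \<in> borel_measurable (coord_lborel {..<n})"
    by measurable
  fix i
  consider "i < n" | "i = n" | "i > n" by linarith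
  then show "(\<lambda>u. hemisphere_param n s u i) \<in> borel_measurable (coord_lborel {..<n})"
    by cases (simp_all add: hemisphere_param_def)
qed

lemma sqnorm_Suc: "sqnorm (Suc n) x = sqnorm n x + (x n)\<^sup>2"
  by (simp add: sqnorm_def)

lemma hemisphere_param_in_nsphere:
  assumes "sqnorm n u < 1" "s\<^sup>2 = 1"
  shows "hemisphere_param n s u \<in> topspace (nsphere n)"
proof -
  have "sqnorm n (hemisphere_param n s u) = sqnorm n u"
    by (simp add: sqnorm_def hemisphere_param_def)
  moreover have "hemisphere_param n s u n = s * sqrt (1 - sqnorm n u)"
    by (simp add: hemisphere_param_def sqnorm_def)
  moreover have "hemisphere_param n s u i = 0" if "i > n" for i
    using that by (simp add: hemisphere_param_def)
  ultimately show ?thesis using assms by (simp add: in_nsphere_iff sqnorm_Suc power_mult_distrib)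
qed

text \<open>Extension by 0 outside the open ball lets the chart integrals run over all of
  \<open>coord_lborel\<close>, so that Fubini and scaling apply directly.\<close>

definition hemisphere_weight :: "nat \<Rightarrow> (nat \<Rightarrow> real) \<Rightarrow> ennreal" where
  "hemisphere_weight n u = ennreal (1 / sqrt (1 - sqnorm n u)) * indicator {u. sqnorm n u < 1} u"

lemma measurable_hemisphere_weight: "hemisphere_weight n \<in> borel_measurable (coord_lborel {..<n})"
proof -
  note measurable_sqnorm[measurable]
  show ?thesis unfolding hemisphere_weight_def by measurable
qed

lemma nn_integral_sphere_volume:
  assumes G[measurable]: "G \<in> borel_measurable borel"
  shows "(\<integral>\<^sup>+x. G x \<partial>sphere_volume n) =
    (\<Sum>s\<in>{-1, 1}. \<integral>\<^sup>+u. G (hemisphere_param n s u) * hemisphere_weight n u \<partial>coord_lborel {..<n})"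
proof -
  note [measurable] = measurable_sqnorm measurable_hemisphere_param measurable_hemisphere_weight
  define D where "D = {u. sqnorm n u < 1}"
  have D: "{u. (\<Sum>j<n. (u j)\<^sup>2) < 1} = D" by (simp add: D_def sqnorm_def)
  have Dsets: "D \<inter> space (coord_lborel {..<n}) \<in> sets (coord_lborel {..<n})"
  proof -
    have "{u \<in> space (coord_lborel {..<n}). sqnorm n u < 1} \<in> sets (coord_lborel {..<n})" by measurable
    then show ?thesis by (simp add: D_def Int_def conj_commute)
  qed
  define M where "M = restrict_space (coord_lborel {..<n}) D"
  define P where "P = count_space {-1, 1::real} \<Otimes>\<^sub>M M"
  have spM: "space M \<subseteq> D" by (auto simp: M_def space_restrict_space)
  have spP: "space P = {-1, 1} \<times> space M" by (simp add: P_def space_pair_measure)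
  \<comment> \<open>\<open>D\<close> also contains functions outside the product space. Cutting it
    down to the space leaves the restricted measure unchanged and gives a measurable set, as
    sigma-finiteness requires.\<close>
  have "M = restrict_space (coord_lborel {..<n}) (D \<inter> space (coord_lborel {..<n}))"
  proof -
    have "(\<inter>) D ` sets (coord_lborel {..<n}) = (\<inter>) (D \<inter> space (coord_lborel {..<n})) ` sets (coord_lborel {..<n})"
      by (intro image_cong refl) (use sets.sets_into_space in blast)
    then show ?thesis by (simp add: M_def restrict_space_def Int_assoc)
  qed
  then interpret M: sigma_finite_measure M
    using Dsets lborel_product.sigma_finite[of "{..<n}"]
    by (simp add: sigma_finite_measure_restrict_space)
  let ?w = "\<lambda>(s, u). ennreal (sqrt (Determinant.det (pullback_metric n (hemisphere_param n s) u)))"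
  have w: "?w \<in> borel_measurable P"
    and weq: "\<And>s u. (s, u) \<in> space P \<Longrightarrow> ?w (s, u) = hemisphere_weight n u"
  proof -
    show weq: "?w (s, u) = hemisphere_weight n u" if "(s, u) \<in> space P" for s u
      using that spM by (auto simp: spP D_def hemisphere_weight_def sqrt_det_hemisphere)
    \<comment> \<open>The determinant of derivatives is measurable because it agrees on
      \<open>space P\<close> with the explicit weight.\<close>
    have "hemisphere_weight n \<in> borel_measurable M"
      unfolding M_def by (intro measurable_restrict_space1) measurable
    then have "(\<lambda>(s, u). hemisphere_weight n u) \<in> borel_measurable P"
      unfolding P_def by measurable
    then show "?w \<in> borel_measurable P"
      by (rule measurable_cong[THEN iffD1, rotated]) (use weq in auto)
  qed
  have param: "(\<lambda>(s, u). hemisphere_param n s u) \<in> P \<rightarrow>\<^sub>M restrict_space borel (topspace (nsphere n))"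
  proof (rule measurable_restrict_space2)
    show "(\<lambda>(s, u). hemisphere_param n s u) \<in> space P \<rightarrow> topspace (nsphere n)"
      using spM by (auto simp: spP D_def intro!: hemisphere_param_in_nsphere)
    show "(\<lambda>(s, u). hemisphere_param n s u) \<in> P \<rightarrow>\<^sub>M borel"
      unfolding P_def
    \<comment> \<open>The first factor consists of the two signs, so each sign is checked
      separately.\<close>
    proof (rule measurable_pair_measure_countable1)
      fix s :: real
      have "hemisphere_param n s \<in> M \<rightarrow>\<^sub>M borel"
        unfolding M_def by (intro measurable_restrict_space1) measurable
      then show "(\<lambda>u. case (s, u) of (s, u) \<Rightarrow> hemisphere_param n s u) \<in> M \<rightarrow>\<^sub>M borel" by simp
    qed simp
  qed
  have Gr: "G \<in> borel_measurable (restrict_space borel (topspace (nsphere n)))"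
    by (intro measurable_restrict_space1) measurable
  have "(\<integral>\<^sup>+x. G x \<partial>sphere_volume n) = (\<integral>\<^sup>+z. G ((\<lambda>(s, u). hemisphere_param n s u) z) \<partial>density P ?w)"
    unfolding sphere_volume_def D M_def[symmetric] P_def[symmetric]
    using param Gr by (intro nn_integral_distr) (auto simp: measurable_density_eq1)
  also have "\<dots> = (\<integral>\<^sup>+z. ?w z * G ((\<lambda>(s, u). hemisphere_param n s u) z) \<partial>P)"
    using w measurable_compose[OF param Gr] by (rule nn_integral_density)
  also have "\<dots> = (\<integral>\<^sup>+z. (\<lambda>(s, u). G (hemisphere_param n s u) * hemisphere_weight n u) z \<partial>P)"
    using weq by (intro nn_integral_cong) (auto simp: mult.commute)
  also have "\<dots> = (\<integral>\<^sup>+s. \<integral>\<^sup>+u. G (hemisphere_param n s u) * hemisphere_weight n u \<partial>M \<partial>count_space {-1, 1})"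
    unfolding P_def
  proof (subst M.nn_integral_fst[symmetric])
    show "(\<lambda>(s, u). G (hemisphere_param n s u) * hemisphere_weight n u) \<in> borel_measurable (count_space {-1, 1} \<Otimes>\<^sub>M M)"
    proof (rule measurable_pair_measure_countable1)
      fix s :: real
      have "(\<lambda>u. G (hemisphere_param n s u) * hemisphere_weight n u) \<in> borel_measurable M"
        unfolding M_def by (intro measurable_restrict_space1) measurable
      then show "(\<lambda>u. case (s, u) of (s, u) \<Rightarrow> G (hemisphere_param n s u) * hemisphere_weight n u) \<in> borel_measurable M" by simp
    qed simp
  qed simp
  also have "\<dots> = (\<Sum>s\<in>{-1, 1}. \<integral>\<^sup>+u. G (hemisphere_param n s u) * hemisphere_weight n u \<partial>M)"
    by (rule nn_integral_count_space_finite) simp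
  also have "\<dots> = (\<Sum>s\<in>{-1, 1}. \<integral>\<^sup>+u. G (hemisphere_param n s u) * hemisphere_weight n u \<partial>coord_lborel {..<n})"
    unfolding M_def using Dsets
    by (intro sum.cong refl, subst nn_integral_restrict_space)
       (auto intro!: nn_integral_cong simp: Int_commute hemisphere_weight_def D_def split: split_indicator)
  finally show ?thesis .
qed

section \<open>Integration in polar coordinates\<close>

lemma nn_integral_indicator_SUP:
  fixes f :: "real \<Rightarrow> ennreal" and b :: "nat \<Rightarrow> real"
  assumes [measurable]: "f \<in> borel_measurable borel" and b: "incseq b" "\<And>x. \<exists>m. x \<le> b m"
  shows "(\<integral>\<^sup>+x. f x * indicator {a<..} x \<partial>lborel) = (SUP m. \<integral>\<^sup>+x. f x * indicator {a<..b m} x \<partial>lborel)"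
proof (subst nn_integral_monotone_convergence_SUP[symmetric])
  show "incseq (\<lambda>m x. f x * indicator {a<..b m} x)"
    using b(1) by (auto simp: incseq_def le_fun_def split: split_indicator intro: order_trans)
  show "(\<integral>\<^sup>+x. f x * indicator {a<..} x \<partial>lborel) = (\<integral>\<^sup>+x. (SUP m. f x * indicator {a<..b m} x) \<partial>lborel)"
  proof (intro nn_integral_cong antisym)
    fix x
    obtain m where "x \<le> b m" using b(2) by blast
    then have "f x * indicator {a<..} x \<le> f x * indicator {a<..b m} x" by (auto split: split_indicator)
    then show "f x * indicator {a<..} x \<le> (SUP m. f x * indicator {a<..b m} x)"
      by (rule SUP_upper2[rotated]) simp
    show "(SUP m. f x * indicator {a<..b m} x) \<le> f x * indicator {a<..} x"
      by (rule SUP_least) (auto split: split_indicator)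
  qed
qed auto

text \<open>In the polar formula \<open>w\<close> is the last coordinate, \<open>a\<close> the norm
  of the others and \<open>t\<close> the radius. The substitution runs from \<open>w\<close> to
  \<open>t\<close>, where the derivative \<open>w / g w\<close> is continuous; the inverse has an
  unbounded derivative at \<open>a\<close>. Compact intervals are exhausted afterwards.\<close>

lemma nn_integral_pythagoras_substitution:
  fixes h :: "real \<Rightarrow> ennreal"
  assumes h[measurable]: "h \<in> borel_measurable borel" and a: "0 \<le> a"
  shows "(\<integral>\<^sup>+w. h w * indicator {0<..} w \<partial>lborel) =
    (\<integral>\<^sup>+t. h (sqrt (t\<^sup>2 - a\<^sup>2)) * ennreal (t / sqrt (t\<^sup>2 - a\<^sup>2)) * indicator {a<..} t \<partial>lborel)"
proof (cases "a = 0")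
  \<comment> \<open>For \<open>a = 0\<close> the substitution is the identity; it is split off
    because \<open>g\<close> vanishes at 0 and \<open>w / g w\<close> is then not continuous
    there.\<close>
  case True
  then show ?thesis by (intro nn_integral_cong) (auto split: split_indicator)
next
  case False
  then have a: "a > 0" using a by simp
  define f where "f t = h (sqrt (t\<^sup>2 - a\<^sup>2)) * ennreal (t / sqrt (t\<^sup>2 - a\<^sup>2))" for t
  define g where "g w = sqrt (a\<^sup>2 + w\<^sup>2)" for w
  have f[measurable]: "f \<in> borel_measurable borel" unfolding f_def by measurable
  have gpos: "g w > 0" for w using a by (simp add: g_def add_pos_nonneg)
  have fg: "f (g w) * ennreal (w / g w) = h w" if "w > 0" for w
  proof -
    have "sqrt ((g w)\<^sup>2 - a\<^sup>2) = w" using that by (simp add: g_def)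
    then have "f (g w) * ennreal (w / g w) = h w * (ennreal (g w / w) * ennreal (w / g w))"
      by (simp add: f_def mult.assoc)
    also have "ennreal (g w / w) * ennreal (w / g w) = 1"
      using gpos[of w] that by (simp flip: ennreal_mult)
    finally show ?thesis by simp
  qed
  \<comment> \<open>Division by zero gives 0 at \<open>t = a\<close>, so the half-open interval may
    be closed.\<close>
  have fa: "f a = 0" by (simp add: f_def)
  have eq: "(\<integral>\<^sup>+t. f t * indicator {a<..g (real m)} t \<partial>lborel) = (\<integral>\<^sup>+w. h w * indicator {0<..real m} w \<partial>lborel)" for m
  proof (cases "m = 0")
    case True
    then show ?thesis using a by (simp add: g_def)
  next
    case False
    have "(\<integral>\<^sup>+t. f t * indicator {a<..g (real m)} t \<partial>lborel) = (\<integral>\<^sup>+t. f t * indicator {g 0..g (real m)} t \<partial>lborel)"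
      using a fa by (intro nn_integral_cong) (auto simp: g_def less_le split: split_indicator)
    also have "\<dots> = (\<integral>\<^sup>+w. f (g w) * (w / g w) * indicator {0..real m} w \<partial>lborel)"
    proof (rule nn_integral_substitution_aux)
      fix w :: real assume "w \<in> {0..real m}"
      show "(g has_real_derivative w / g w) (at w)"
        unfolding g_def using gpos[of w]
        by (auto intro!: derivative_eq_intros simp: g_def field_simps)
      show "0 \<le> w / g w" using \<open>w \<in> _\<close> gpos[of w] by auto
    next
      have "g w \<noteq> 0" for w using gpos[of w] by simp
      moreover have "continuous_on {0..real m} g" unfolding g_def by (intro continuous_intros)
      ultimately show "continuous_on {0..real m} (\<lambda>w. w / g w)" by (intro continuous_intros) auto
    qed (use False in auto)
    also have "\<dots> = (\<integral>\<^sup>+w. h w * indicator {0<..real m} w \<partial>lborel)"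
      using fg by (intro nn_integral_cong) (auto split: split_indicator simp: le_less)
    finally show ?thesis .
  qed
  have g_le: "w \<le> g w" for w unfolding g_def by (rule real_le_rsqrt) simp
  have "(\<integral>\<^sup>+w. h w * indicator {0<..} w \<partial>lborel) = (SUP m. \<integral>\<^sup>+w. h w * indicator {0<..real m} w \<partial>lborel)"
    by (rule nn_integral_indicator_SUP) (auto simp: incseq_def real_arch_simple)
  also have "\<dots> = (SUP m. \<integral>\<^sup>+t. f t * indicator {a<..g (real m)} t \<partial>lborel)" by (simp add: eq)
  also have "\<dots> = (\<integral>\<^sup>+t. f t * indicator {a<..} t \<partial>lborel)"
  proof (rule nn_integral_indicator_SUP[symmetric])
    show "incseq (\<lambda>m. g (real m))" by (auto simp: incseq_def g_def intro!: power_mono)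
    show "\<exists>m. x \<le> g (real m)" for x using real_arch_simple[of x] g_le order_trans by blast
  qed auto
  finally show ?thesis by (simp add: f_def)
qed

text \<open>The sign of the last coordinate becomes the choice of hemisphere in
  \<open>nn_integral_sphere_volume\<close>.\<close>

lemma nn_integral_split_sign:
  fixes \<phi> :: "real \<Rightarrow> ennreal"
  assumes [measurable]: "\<phi> \<in> borel_measurable borel"
  shows "(\<integral>\<^sup>+w. \<phi> w \<partial>lborel) = (\<Sum>s\<in>{-1, 1}. \<integral>\<^sup>+w. \<phi> (s * w) * indicator {0<..} w \<partial>lborel)"
proof -
  have "(\<integral>\<^sup>+w. \<phi> w \<partial>lborel) = (\<integral>\<^sup>+w. \<phi> w * indicator {..<0} w + \<phi> w * indicator {0<..} w \<partial>lborel)"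
    by (rule nn_integral_cong_AE, rule AE_mp[OF AE_lborel_singleton[of 0]])
       (auto split: split_indicator)
  also have "\<dots> = (\<integral>\<^sup>+w. \<phi> w * indicator {..<0} w \<partial>lborel) + (\<integral>\<^sup>+w. \<phi> w * indicator {0<..} w \<partial>lborel)"
    by (rule nn_integral_add) auto
  also have "(\<integral>\<^sup>+w. \<phi> w * indicator {..<0} w \<partial>lborel) = (\<integral>\<^sup>+w. \<phi> (- w) * indicator {0<..} w \<partial>lborel)"
    by (subst nn_integral_real_affine[of _ "-1" 0]) (auto intro!: nn_integral_cong split: split_indicator)
  finally show ?thesis by simp
qed

text \<open>For \<open>s\<close> equal to 1 or -1 the updated vector is the one of length
  \<open>t\<close> above or below \<open>v\<close>; division by \<open>t\<close> puts it on the
  hemisphere over \<open>v / t\<close>.\<close>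

lemma radial_proj_eq_hemisphere_param:
  fixes v :: "nat \<Rightarrow> real"
  assumes "sqrt (sqnorm n v) < t"
  shows "sqnorm (Suc n) (v(n := s * sqrt (t\<^sup>2 - sqnorm n v))) = sqnorm n v + s\<^sup>2 * (t\<^sup>2 - sqnorm n v)"
    and "s\<^sup>2 = 1 \<Longrightarrow> radial_proj (Suc n) (v(n := s * sqrt (t\<^sup>2 - sqnorm n v)))
      = hemisphere_param n s (\<lambda>i\<in>{..<n}. 1 / t * v i)"
    and "sqnorm n (\<lambda>i\<in>{..<n}. 1 / t * v i) = sqnorm n v / t\<^sup>2"
proof -
  have t: "t > 0" using assms real_sqrt_ge_zero[OF sqnorm_nonneg[of n v]] by linarith
  have "(sqrt (sqnorm n v))\<^sup>2 < t\<^sup>2" using assms by (rule power_strict_mono) (simp_all add: sqnorm_nonneg)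
  then have lt: "sqnorm n v < t\<^sup>2" by (simp add: sqnorm_nonneg)
  have "sqnorm n (v(n := y)) = sqnorm n v" for y by (simp add: sqnorm_def)
  then show sq: "sqnorm (Suc n) (v(n := s * sqrt (t\<^sup>2 - sqnorm n v))) = sqnorm n v + s\<^sup>2 * (t\<^sup>2 - sqnorm n v)"
    using lt by (simp add: sqnorm_Suc power_mult_distrib)
  show sq': "sqnorm n (\<lambda>i\<in>{..<n}. 1 / t * v i) = sqnorm n v / t\<^sup>2"
    by (simp add: sqnorm_def power_divide sum_divide_distrib)
  assume s: "s\<^sup>2 = 1"
  have "sqrt (1 - sqnorm n v / t\<^sup>2) = sqrt (t\<^sup>2 - sqnorm n v) / t"
  proof -
    have "1 - sqnorm n v / t\<^sup>2 = (t\<^sup>2 - sqnorm n v) / t\<^sup>2" using t by (simp add: diff_divide_distrib)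
    then show ?thesis using t by (simp add: real_sqrt_divide)
  qed
  moreover have "(\<Sum>j<n. ((\<lambda>i\<in>{..<n}. 1 / t * v i) j)\<^sup>2) = sqnorm n v / t\<^sup>2" using sq' by (simp only: sqnorm_def)
  ultimately show "radial_proj (Suc n) (v(n := s * sqrt (t\<^sup>2 - sqnorm n v)))
      = hemisphere_param n s (\<lambda>i\<in>{..<n}. 1 / t * v i)"
    using t unfolding radial_proj_def hemisphere_param_def sq s
    by (auto simp: fun_eq_iff less_Suc_eq)
qed

lemma measurable_radial_proj: "radial_proj k \<in> coord_lborel {..<k} \<rightarrow>\<^sub>M borel"
  by (rule measurable_coordinatewise_then_product) (rule measurable_radial_proj_coord)

text \<open>The last coordinate is traded for the radius \<open>t\<close>, then
  \<open>v = t u\<close> is substituted. The first Jacobian is the hemisphere weight at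
  \<open>v / t\<close>, the second is \<open>t ^ n\<close>, and the Gaussian depends on
  \<open>t\<close> alone, so the integral factors.\<close>

lemma nn_integral_gauss_polar:
  assumes G[measurable]: "G \<in> borel_measurable borel"
  shows "(\<integral>\<^sup>+x. G (radial_proj (Suc n) x) * ennreal (exp (- sqnorm (Suc n) x / 2)) \<partial>coord_lborel {..<Suc n}) =
    (\<integral>\<^sup>+t. ennreal (t ^ n * exp (- t\<^sup>2 / 2)) * indicator {0<..} t \<partial>lborel) * (\<integral>\<^sup>+x. G x \<partial>sphere_volume n)"
proof -
  note [measurable] = measurable_sqnorm measurable_hemisphere_param measurable_hemisphere_weight measurable_radial_proj
  define \<Phi> where "\<Phi> x = G (radial_proj (Suc n) x) * ennreal (exp (- sqnorm (Suc n) x / 2))" for x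
  have \<Phi>: "\<Phi> \<in> borel_measurable (coord_lborel {..<Suc n})" unfolding \<Phi>_def by measurable
  have Suc_n: "{..<Suc n} = insert n {..<n}" by auto
  have \<Phi>'[measurable]: "\<Phi> \<in> borel_measurable (coord_lborel (insert n {..<n}))" using \<Phi> by (simp add: Suc_n)
  define J where "J s u = G (hemisphere_param n s u) * hemisphere_weight n u" for s u
  have J[measurable]: "J s \<in> borel_measurable (coord_lborel {..<n})" for s unfolding J_def by measurable
  define E where "E t = ennreal (exp (- t\<^sup>2 / 2)) * indicator {0<..} t" for t :: real
  have E[measurable]: "E \<in> borel_measurable borel" unfolding E_def by measurable
  interpret pair: pair_sigma_finite "coord_lborel {..<n}" "lborel :: real measure"
    by (intro pair_sigma_finite.intro lborel_product.sigma_finite sigma_finite_lborel) simp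
  have inner: "(\<integral>\<^sup>+w. \<Phi> (v(n := w)) \<partial>lborel) = (\<Sum>s\<in>{-1, 1}. \<integral>\<^sup>+t. J s (\<lambda>i\<in>{..<n}. 1 / t * v i) * E t \<partial>lborel)"
    if v: "v \<in> space (coord_lborel {..<n})" for v
  proof -
    have upd[measurable]: "(\<lambda>w. v(n := w)) \<in> borel \<rightarrow>\<^sub>M coord_lborel (insert n {..<n})"
      using measurable_component_update[OF v, of n] by simp
    define a where "a = sqrt (sqnorm n v)"
    have a: "a \<ge> 0" "a\<^sup>2 = sqnorm n v" by (simp_all add: a_def sqnorm_nonneg)
    have "(\<integral>\<^sup>+w. \<Phi> (v(n := w)) \<partial>lborel) = (\<Sum>s\<in>{-1, 1}. \<integral>\<^sup>+w. \<Phi> (v(n := s * w)) * indicator {0<..} w \<partial>lborel)"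
      by (rule nn_integral_split_sign) measurable
    also have "\<dots> = (\<Sum>s\<in>{-1, 1}. \<integral>\<^sup>+t. J s (\<lambda>i\<in>{..<n}. 1 / t * v i) * E t \<partial>lborel)"
    proof (rule sum.cong[OF refl])
      fix s :: real assume "s \<in> {-1, 1}"
      then have s: "s\<^sup>2 = 1" by auto
      have "(\<integral>\<^sup>+w. \<Phi> (v(n := s * w)) * indicator {0<..} w \<partial>lborel) =
        (\<integral>\<^sup>+t. \<Phi> (v(n := s * sqrt (t\<^sup>2 - a\<^sup>2))) * ennreal (t / sqrt (t\<^sup>2 - a\<^sup>2)) * indicator {a<..} t \<partial>lborel)"
        by (rule nn_integral_pythagoras_substitution[of "\<lambda>w. \<Phi> (v(n := s * w))"]) (use a in auto)
      also have "\<dots> = (\<integral>\<^sup>+t. J s (\<lambda>i\<in>{..<n}. 1 / t * v i) * E t \<partial>lborel)"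
      proof (rule nn_integral_cong)
        fix t :: real
        show "\<Phi> (v(n := s * sqrt (t\<^sup>2 - a\<^sup>2))) * ennreal (t / sqrt (t\<^sup>2 - a\<^sup>2)) * indicator {a<..} t
          = J s (\<lambda>i\<in>{..<n}. 1 / t * v i) * E t"
        proof (cases "a < t")
          case True
          then have t: "t > 0" and at: "a\<^sup>2 < t\<^sup>2" using a(1) by (auto intro: power_strict_mono)
          have lt: "sqrt (sqnorm n v) < t" using True by (simp add: a_def)
          note P = radial_proj_eq_hemisphere_param[OF lt]
          have "1 - a\<^sup>2 / t\<^sup>2 = (t\<^sup>2 - a\<^sup>2) / t\<^sup>2" using t by (simp add: diff_divide_distrib)
          then have "1 / sqrt (1 - a\<^sup>2 / t\<^sup>2) = t / sqrt (t\<^sup>2 - a\<^sup>2)" using t by (simp add: real_sqrt_divide)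
          moreover have "a\<^sup>2 / t\<^sup>2 < 1" using at t by simp
          ultimately have "hemisphere_weight n (\<lambda>i\<in>{..<n}. 1 / t * v i) = ennreal (t / sqrt (t\<^sup>2 - a\<^sup>2))"
            unfolding hemisphere_weight_def indicator_def mem_Collect_eq P(3) a(2)[symmetric] by simp
          moreover have "\<Phi> (v(n := s * sqrt (t\<^sup>2 - a\<^sup>2))) = G (hemisphere_param n s (\<lambda>i\<in>{..<n}. 1 / t * v i)) * ennreal (exp (- t\<^sup>2 / 2))"
            unfolding \<Phi>_def a(2) P(1) P(2)[OF s] s by simp
          ultimately show ?thesis using True t by (simp add: J_def E_def mult_ac)
        next
          case False
          \<comment> \<open>For \<open>t\<close> at most \<open>a\<close> the point
            \<open>v / t\<close> is outside the open ball, so the weight vanishes. The range of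
            \<open>t\<close> thereby becomes independent of \<open>v\<close>, ready for
            Fubini.\<close>
          have "hemisphere_weight n (\<lambda>i\<in>{..<n}. 1 / t * v i) = 0" if t: "t > 0"
          proof -
            have "sqnorm n (\<lambda>i\<in>{..<n}. 1 / t * v i) = a\<^sup>2 / t\<^sup>2"
              by (simp add: a(2) sqnorm_def power_divide sum_divide_distrib)
            moreover have "t\<^sup>2 \<le> a\<^sup>2" using False t by (intro power_mono) auto
            ultimately have "\<not> sqnorm n (\<lambda>i\<in>{..<n}. 1 / t * v i) < 1" using t by simp
            then show ?thesis by (simp add: hemisphere_weight_def)
          qed
          then show ?thesis using False by (cases "t > 0") (simp_all add: J_def E_def)
        qed
      qed
      finally show "(\<integral>\<^sup>+w. \<Phi> (v(n := s * w)) * indicator {0<..} w \<partial>lborel) = (\<integral>\<^sup>+t. J s (\<lambda>i\<in>{..<n}. 1 / t * v i) * E t \<partial>lborel)" .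
    qed
    finally show ?thesis .
  qed
  have sc[measurable]: "(\<lambda>(v, t). \<lambda>i\<in>{..<n}. 1 / t * v i) \<in> coord_lborel {..<n} \<Otimes>\<^sub>M borel \<rightarrow>\<^sub>M coord_lborel {..<n}"
    unfolding split_beta by (intro measurable_restrict) measurable
  have JE[measurable]: "(\<lambda>(v, t). J s (\<lambda>i\<in>{..<n}. 1 / t * v i) * E t) \<in> borel_measurable (coord_lborel {..<n} \<Otimes>\<^sub>M lborel)" for s
    using measurable_compose[OF sc J[of s]] by (simp add: split_beta')
  \<comment> \<open>At fixed radius the dilation \<open>v = t u\<close> contributes
    \<open>t ^ n\<close>; for nonpositive \<open>t\<close> both sides vanish through
    \<open>E\<close>.\<close>
  have scaled: "(\<integral>\<^sup>+v. J s (\<lambda>i\<in>{..<n}. 1 / t * v i) * E t \<partial>coord_lborel {..<n})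
    = (ennreal (t ^ n * exp (- t\<^sup>2 / 2)) * indicator {0<..} t) * (\<integral>\<^sup>+u. J s u \<partial>coord_lborel {..<n})" for s t
  proof (cases "t > 0")
    case True
    have [measurable]: "(\<lambda>v. \<lambda>i\<in>{..<n}. 1 / t * v i) \<in> coord_lborel {..<n} \<rightarrow>\<^sub>M coord_lborel {..<n}"
      by (intro measurable_restrict) measurable
    have "ennreal (t ^ n) * (\<integral>\<^sup>+u. J s u \<partial>coord_lborel {..<n})
      = ennreal (t ^ n) * ennreal ((1 / t) ^ n) * (\<integral>\<^sup>+v. J s (\<lambda>i\<in>{..<n}. 1 / t * v i) \<partial>coord_lborel {..<n})"
      using True by (subst nn_integral_coord_scale[where r="1/t"]) (auto simp: mult.assoc)
    also have "ennreal (t ^ n) * ennreal ((1 / t) ^ n) = 1"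
      using True by (simp add: power_divide flip: ennreal_mult)
    finally have "(\<integral>\<^sup>+v. J s (\<lambda>i\<in>{..<n}. 1 / t * v i) \<partial>coord_lborel {..<n}) = ennreal (t ^ n) * (\<integral>\<^sup>+u. J s u \<partial>coord_lborel {..<n})"
      by (simp only: mult_1)
    then show ?thesis using True
      by (subst nn_integral_multc) (auto simp: E_def ennreal_mult mult_ac)
  qed (simp add: E_def)
  have "(\<integral>\<^sup>+x. \<Phi> x \<partial>coord_lborel {..<Suc n}) = (\<integral>\<^sup>+v. \<integral>\<^sup>+w. \<Phi> (v(n := w)) \<partial>lborel \<partial>coord_lborel {..<n})"
    unfolding Suc_n by (rule lborel_product.product_nn_integral_insert) auto
  also have "\<dots> = (\<integral>\<^sup>+v. (\<Sum>s\<in>{-1, 1}. \<integral>\<^sup>+t. J s (\<lambda>i\<in>{..<n}. 1 / t * v i) * E t \<partial>lborel) \<partial>coord_lborel {..<n})"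
    by (rule nn_integral_cong) (rule inner)
  also have "\<dots> = (\<Sum>s\<in>{-1, 1}. \<integral>\<^sup>+v. \<integral>\<^sup>+t. J s (\<lambda>i\<in>{..<n}. 1 / t * v i) * E t \<partial>lborel \<partial>coord_lborel {..<n})"
    using lborel.borel_measurable_nn_integral_fst[OF JE] by (intro nn_integral_sum) auto
  also have "\<dots> = (\<Sum>s\<in>{-1, 1}. \<integral>\<^sup>+t. \<integral>\<^sup>+v. J s (\<lambda>i\<in>{..<n}. 1 / t * v i) * E t \<partial>coord_lborel {..<n} \<partial>lborel)"
    by (intro sum.cong refl pair.Fubini'[symmetric] JE)
  also have "\<dots> = (\<Sum>s\<in>{-1, 1}. (\<integral>\<^sup>+t. ennreal (t ^ n * exp (- t\<^sup>2 / 2)) * indicator {0<..} t \<partial>lborel) * (\<integral>\<^sup>+u. J s u \<partial>coord_lborel {..<n}))"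
    unfolding scaled by (intro sum.cong refl nn_integral_multc) measurable
  also have "\<dots> = (\<integral>\<^sup>+t. ennreal (t ^ n * exp (- t\<^sup>2 / 2)) * indicator {0<..} t \<partial>lborel) * (\<integral>\<^sup>+x. G x \<partial>sphere_volume n)"
    by (simp only: nn_integral_sphere_volume[OF G] J_def sum_distrib_left)
  finally show ?thesis by (simp only: \<Phi>_def)
qed

section \<open>The sphere as an image of the cube\<close>

abbreviation std_normal :: "real measure" where
  "std_normal \<equiv> density lborel (\<lambda>x. ennreal (std_normal_density x))"

interpretation std_normal: cdf_distribution std_normal
proof -
  interpret prob_space std_normal by (rule prob_space_normal_density) simp
  show "cdf_distribution std_normal" by unfold_locales simp_all
qed

text \<open>The generalised inverse of the distribution function, as in Skorokhod's construction.
  The value 0 off the open interval makes it total and is not seen by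
  \<open>unit_uniform\<close>.\<close>

definition normal_quantile :: "real \<Rightarrow> real" where
  "normal_quantile \<omega> = (if \<omega> \<in> {0<..<1} then Inf {x. \<omega> \<le> cdf std_normal x} else 0)"

lemma measurable_normal_quantile: "normal_quantile \<in> borel_measurable borel"
  unfolding normal_quantile_def[abs_def]
  using std_normal.measurable_CI by (subst measurable_restrict_space_iff[symmetric]) auto

text \<open>By \<open>distr_I_eq_M\<close> the generalised inverse carries the uniform measure to
  the normal one. The conclusion has the shape of \<open>eq\<close> in
  \<open>nn_integral_PiM_transform\<close>.\<close>

lemma nn_integral_normal_quantile:
  assumes [measurable]: "f \<in> borel_measurable borel"
  shows "(\<integral>\<^sup>+u. f (normal_quantile u) \<partial>unit_uniform) = (\<integral>\<^sup>+x. f x * ennreal (std_normal_density x) \<partial>lborel)"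
proof -
  note measurable_normal_quantile[measurable]
  have "(\<integral>\<^sup>+u. f (normal_quantile u) \<partial>unit_uniform)
    = (\<integral>\<^sup>+u. f (normal_quantile u) * indicator {0<..<1} u \<partial>lborel)"
    by (rule nn_integral_unit_uniform) measurable
  also have "\<dots> = (\<integral>\<^sup>+u. f (normal_quantile u) \<partial>restrict_space lborel {0<..<1})"
    by (subst nn_integral_restrict_space) auto
  also have "\<dots> = (\<integral>\<^sup>+u. f (Inf {x. u \<le> cdf std_normal x}) \<partial>restrict_space lborel {0<..<1})"
    by (intro nn_integral_cong) (auto simp: space_restrict_space normal_quantile_def)
  also have "\<dots> = (\<integral>\<^sup>+x. f x \<partial>distr (restrict_space lborel {0<..<1}) borel (\<lambda>u. Inf {x. u \<le> cdf std_normal x}))"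
  proof (rule nn_integral_distr[symmetric])
    show "(\<lambda>u. Inf {x. u \<le> cdf std_normal x}) \<in> restrict_space lborel {0<..<1} \<rightarrow>\<^sub>M borel"
      using std_normal.measurable_CI by (simp cong: measurable_cong_sets sets_restrict_space_cong)
  qed simp
  also have "\<dots> = (\<integral>\<^sup>+x. f x \<partial>std_normal)" by (simp only: std_normal.distr_I_eq_M)
  also have "\<dots> = (\<integral>\<^sup>+x. f x * ennreal (std_normal_density x) \<partial>lborel)"
    by (subst nn_integral_density) (auto simp: mult.commute)
  finally show ?thesis .
qed

text \<open>The density is positive, so no interval of positive length is null. A flat piece of the
  distribution function would be a jump of the quantile.\<close>

lemma cdf_std_normal_strict_mono:
  assumes "x < y"
  shows "cdf std_normal x < cdf std_normal y"
proof -
  have "emeasure std_normal {x<..y} \<noteq> 0"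
  proof
    assume "emeasure std_normal {x<..y} = 0"
    then have "AE z in lborel. ennreal (std_normal_density z) * indicator {x<..y} z = 0"
      by (simp add: emeasure_density nn_integral_0_iff_AE)
    then have "AE z in lborel. z \<notin> {x<..y}"
    proof eventually_elim
      case (elim z)
      then show ?case using normal_density_pos[of 1 0 z] by (auto simp: indicator_def ennreal_eq_0_iff)
    qed
    then have "emeasure lborel {x<..y} = 0"
      by (subst (asm) AE_iff_measurable[of "{x<..y}"]) auto
    then show False using assms by simp
  qed
  then have "measure std_normal {x<..y} \<noteq> 0" by (simp add: std_normal.emeasure_eq_measure)
  then show ?thesis using std_normal.cdf_diff_eq[OF assms] measure_nonneg[of std_normal "{x<..y}"] by linarith
qed

lemma isCont_normal_quantile:
  assumes \<omega>: "\<omega> \<in> {0<..<1}"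
  shows "isCont normal_quantile \<omega>"
proof -
  have inv: "v \<le> cdf std_normal x \<longleftrightarrow> normal_quantile v \<le> x" if "v \<in> {0<..<1}" for v x
    using that std_normal.pseudoinverse[of v x] by (simp add: normal_quantile_def)
  have ev: "\<forall>\<^sub>F v in at \<omega>. v \<in> {0<..<1}"
    using \<omega> by (intro eventually_at_topological[THEN iffD2] exI[of _ "{0<..<1}"]) auto
  show ?thesis unfolding isCont_def
  proof (rule order_tendstoI)
    fix a assume "a < normal_quantile \<omega>"
    then have "cdf std_normal a < \<omega>" using inv[OF \<omega>, of a] by auto
    then have "\<forall>\<^sub>F v in at \<omega>. cdf std_normal a < v"
      by (intro order_tendstoD(1)[OF tendsto_ident_at])
    with ev show "\<forall>\<^sub>F v in at \<omega>. a < normal_quantile v"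
      by eventually_elim (use inv in \<open>simp add: not_le[symmetric]\<close>)
  next
    fix a assume "normal_quantile \<omega> < a"
    \<comment> \<open>The Galois connection \<open>inv\<close> yields only weak upper bounds for the
      quantile; the intermediate \<open>c\<close> leaves room for a strict one.\<close>
    then obtain c where c: "normal_quantile \<omega> < c" "c < a" using dense by blast
    have "\<omega> \<le> cdf std_normal (normal_quantile \<omega>)" using inv[OF \<omega>] by simp
    also have "\<dots> < cdf std_normal c" using c(1) by (rule cdf_std_normal_strict_mono)
    finally have "\<forall>\<^sub>F v in at \<omega>. v < cdf std_normal c"
      by (intro order_tendstoD(2)[OF tendsto_ident_at])
    with ev show "\<forall>\<^sub>F v in at \<omega>. normal_quantile v < a"
    proof eventually_elim
      case (elim v)
      then have "normal_quantile v \<le> c" using inv[of v c] by simp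
      then show ?case using c(2) by simp
    qed
  qed
qed

section \<open>Directions and distances on the sphere\<close>

lemma AE_sqnorm_neq_0: "AE x in coord_lborel {..<Suc n}. sqnorm (Suc n) x \<noteq> 0"
proof -
  have ins: "{..<Suc n} = insert n {..<n}" by auto
  have "(\<integral>\<^sup>+x. indicator {0} (x n) \<partial>coord_lborel {..<Suc n}) = (\<integral>\<^sup>+v. \<integral>\<^sup>+w. indicator {0} ((v(n := w)) n) \<partial>lborel \<partial>coord_lborel {..<n})"
    unfolding ins by (rule lborel_product.product_nn_integral_insert) auto
  also have "\<dots> = 0" by simp
  finally have "AE x in coord_lborel {..<Suc n}. indicator {0} (x n) = (0::ennreal)"
    by (subst (asm) nn_integral_0_iff_AE) auto
  then show ?thesis
  proof eventually_elim
    case (elim x)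
    then have "x n \<noteq> 0" by (auto simp: indicator_def)
    then show ?case using sqnorm_nonneg[of n x] by (simp add: sqnorm_Suc add_nonneg_eq_0_iff)
  qed
qed

text \<open>At the origin \<open>radial_proj\<close> is the zero vector. Sending the origin to the
  pole instead makes every value a point of the sphere, where \<open>f\<close> may be
  evaluated.\<close>

definition direction :: "nat \<Rightarrow> (nat \<Rightarrow> real) \<Rightarrow> nat \<Rightarrow> real" where
  "direction n x = (if sqnorm (Suc n) x = 0 then (\<lambda>i. if i = n then 1 else 0) else radial_proj (Suc n) x)"

lemma direction_in_nsphere: "direction n x \<in> topspace (nsphere n)"
proof (cases "sqnorm (Suc n) x = 0")
  case True
  have "(\<Sum>i<n. (if i = n then 1 else 0 :: real)\<^sup>2) = 0" by (intro sum.neutral) auto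
  then show ?thesis using True by (simp add: direction_def in_nsphere_iff sqnorm_def)
next
  case False
  define S where "S = sqnorm (Suc n) x"
  have S: "S \<noteq> 0" "0 \<le> S" using False by (simp_all add: S_def sqnorm_nonneg)
  have "sqnorm (Suc n) (radial_proj (Suc n) x) = (\<Sum>i<Suc n. (x i)\<^sup>2 / S)"
    unfolding sqnorm_def[of _ "radial_proj (Suc n) x"]
    using S by (intro sum.cong) (auto simp: radial_proj_def power_divide S_def[symmetric])
  also have "\<dots> = S / S" by (simp only: sum_divide_distrib[symmetric] S_def sqnorm_def)
  finally have "sqnorm (Suc n) (radial_proj (Suc n) x) = 1" using S by simp
  then show ?thesis using False by (simp add: direction_def in_nsphere_iff radial_proj_def)
qed

lemma sqrt_sqnorm_times_direction: "i < Suc n \<Longrightarrow> sqrt (sqnorm (Suc n) x) * direction n x i = x i"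
proof (cases "sqnorm (Suc n) x = 0")
  case True
  assume "i < Suc n"
  moreover have "\<forall>i\<in>{..<Suc n}. (x i)\<^sup>2 = 0"
    using True unfolding sqnorm_def by (subst (asm) sum_nonneg_eq_0_iff) auto
  ultimately show ?thesis using True by simp
next
  case False
  assume "i < Suc n"
  then show ?thesis using False by (simp add: direction_def radial_proj_def)
qed

lemma direction_nsphere: "x \<in> topspace (nsphere n) \<Longrightarrow> direction n x = x"
  by (auto simp: in_nsphere_iff direction_def radial_proj_def fun_eq_iff less_Suc_eq)

lemma measurable_direction: "(\<lambda>x. direction n x i) \<in> borel_measurable (coord_lborel {..<Suc n})"
proof -
  note [measurable] = measurable_sqnorm measurable_radial_proj_coord
  have "(\<lambda>x. direction n x i) = (\<lambda>x. if sqnorm (Suc n) x = 0 then (if i = n then 1 else 0) else radial_proj (Suc n) x i)"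
    by (auto simp: direction_def fun_eq_iff)
  then show ?thesis by simp
qed

text \<open>Both sides are expressed through the inner product \<open>d\<close>, which the case of
  radii 1 and 1 eliminates. The factors may be negative: \<open>s = -1\<close> treats the
  antipode.\<close>

lemma edist_nsphere_sq:
  assumes "p \<in> topspace (nsphere n)" "q \<in> topspace (nsphere n)"
  shows "(edist (Suc n) (\<lambda>i. r * p i) (\<lambda>i. s * q i))\<^sup>2 = (r - s)\<^sup>2 + r * s * (edist (Suc n) p q)\<^sup>2"
proof -
  define d where "d = (\<Sum>i<Suc n. p i * q i)"
  have *: "(edist (Suc n) (\<lambda>i. r * p i) (\<lambda>i. s * q i))\<^sup>2 = r\<^sup>2 + s\<^sup>2 - 2 * r * s * d" for r s
  proof -
    have "(edist (Suc n) (\<lambda>i. r * p i) (\<lambda>i. s * q i))\<^sup>2 = sqnorm (Suc n) (\<lambda>i. r * p i - s * q i)"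
      unfolding edist_eq_sqnorm by (rule real_sqrt_pow2[OF sqnorm_nonneg])
    also have "\<dots> = (\<Sum>i<Suc n. (r * p i - s * q i)\<^sup>2)" by (simp only: sqnorm_def)
    also have "\<dots> = (\<Sum>i<Suc n. r\<^sup>2 * (p i)\<^sup>2 + s\<^sup>2 * (q i)\<^sup>2 - 2 * r * s * (p i * q i))"
      by (intro sum.cong refl) (simp add: power2_eq_square algebra_simps)
    also have "\<dots> = r\<^sup>2 * sqnorm (Suc n) p + s\<^sup>2 * sqnorm (Suc n) q - 2 * r * s * d"
      unfolding sqnorm_def d_def by (simp only: sum_subtractf sum.distrib sum_distrib_left)
    finally show ?thesis using assms by (simp add: in_nsphere_iff)
  qed
  have e: "(edist (Suc n) p q)\<^sup>2 = 2 - 2 * d" using *[of 1 1] by simp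
  show ?thesis unfolding *[of r s] e by (simp add: power2_eq_square algebra_simps)
qed

lemma edist_nsphere_le_2:
  assumes "p \<in> topspace (nsphere n)" "q \<in> topspace (nsphere n)"
  shows "edist (Suc n) p q \<le> 2"
proof -
  have "sqrt (sqnorm (Suc n) x) = 1" if "x \<in> topspace (nsphere n)" for x
    using that by (simp add: in_nsphere_iff)
  then have "edist (Suc n) p (\<lambda>_. 0) = 1" "edist (Suc n) (\<lambda>_. 0) q = 1"
    using assms unfolding edist_commute[of _ "\<lambda>_. 0" q] by (simp_all add: edist_eq_sqnorm)
  then show ?thesis using edist_triangle[of "Suc n" p q "\<lambda>_. 0"] by simp
qed

text \<open>By Thales the two distances are legs of a right triangle with hypotenuse 2, and the sum
  of the legs is at most \<open>sqrt 2\<close> times the hypotenuse.\<close>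

lemma edist_nsphere_antipode:
  assumes "p \<in> topspace (nsphere n)" "q \<in> topspace (nsphere n)"
  shows "edist (Suc n) p q + edist (Suc n) p (\<lambda>i. - q i) \<le> 2 * sqrt 2"
proof -
  define a where "a = edist (Suc n) p q"
  define b where "b = edist (Suc n) p (\<lambda>i. - q i)"
  have "b\<^sup>2 = 4 - a\<^sup>2" using edist_nsphere_sq[OF assms, of 1 "-1"] by (simp add: a_def b_def)
  then have "(a + b)\<^sup>2 \<le> (2 * sqrt 2)\<^sup>2"
    using zero_le_power2[of "a - b"] by (simp add: power2_sum power2_diff)
  then show ?thesis unfolding a_def[symmetric] b_def[symmetric] by (rule power2_le_imp_le) simp
qed

section \<open>The mean distance as an integral over the cube\<close>

definition gauss_direction :: "nat \<Rightarrow> (nat \<Rightarrow> real) \<Rightarrow> nat \<Rightarrow> real" where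
  "gauss_direction n u = direction n (\<lambda>i\<in>{..<Suc n}. normal_quantile (u i))"

lemma measurable_quantile_map:
  "(\<lambda>u. \<lambda>i\<in>{..<k}. normal_quantile (u i)) \<in> cube_uniform {..<k} \<rightarrow>\<^sub>M coord_lborel {..<k}"
proof -
  note measurable_normal_quantile[measurable]
  show ?thesis by (intro measurable_restrict) measurable
qed

lemma nn_integral_quantile_map:
  assumes "F \<in> borel_measurable (coord_lborel {..<k})"
  shows "(\<integral>\<^sup>+u. F (\<lambda>i\<in>{..<k}. normal_quantile (u i)) \<partial>cube_uniform {..<k}) =
    (\<integral>\<^sup>+x. F x * ennreal ((1 / sqrt (2 * pi)) ^ k * exp (- sqnorm k x / 2)) \<partial>coord_lborel {..<k})"
proof -
  have "(\<integral>\<^sup>+u. F (\<lambda>i\<in>{..<k}. normal_quantile (u i)) \<partial>cube_uniform {..<k}) =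
    (\<integral>\<^sup>+x. F x * (\<Prod>i<k. ennreal (std_normal_density (x i))) \<partial>coord_lborel {..<k})"
  proof (rule nn_integral_PiM_transform)
    show "sigma_finite_measure unit_uniform"
      by (simp add: prob_space_unit_uniform prob_space_imp_sigma_finite)
    show "normal_quantile \<in> unit_uniform \<rightarrow>\<^sub>M borel"
      using measurable_normal_quantile by (simp cong: measurable_cong_sets)
  qed (auto intro: nn_integral_normal_quantile assms)
  also have "(\<lambda>x. \<Prod>i<k. ennreal (std_normal_density (x i))) = (\<lambda>x. ennreal ((1 / sqrt (2 * pi)) ^ k * exp (- sqnorm k x / 2)))"
  proof
    fix x :: "nat \<Rightarrow> real"
    have "(\<Prod>i<k. std_normal_density (x i)) = (1 / sqrt (2 * pi)) ^ k * (\<Prod>i<k. exp (- (x i)\<^sup>2 / 2))"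
      by (simp add: std_normal_density_def prod.distrib power_divide prod_dividef)
    also have "(\<Prod>i<k. exp (- (x i)\<^sup>2 / 2)) = exp (\<Sum>i<k. - (x i)\<^sup>2 / 2)"
      by (simp add: exp_sum)
    also have "(\<Sum>i<k. - (x i)\<^sup>2 / 2) = - sqnorm k x / 2"
      by (simp add: sqnorm_def sum_negf sum_divide_distrib)
    finally show "(\<Prod>i<k. ennreal (std_normal_density (x i))) = ennreal ((1 / sqrt (2 * pi)) ^ k * exp (- sqnorm k x / 2))"
      by (simp add: prod_ennreal)
  qed
  finally show ?thesis by (simp only: fun_eq_iff)
qed

lemma AE_quantile_map_neq_0:
  "AE u in cube_uniform {..<Suc n}. sqnorm (Suc n) (\<lambda>i\<in>{..<Suc n}. normal_quantile (u i)) \<noteq> 0"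
proof -
  note [measurable] = measurable_sqnorm measurable_quantile_map
  have "(\<integral>\<^sup>+u. indicator {0} (sqnorm (Suc n) (\<lambda>i\<in>{..<Suc n}. normal_quantile (u i))) \<partial>cube_uniform {..<Suc n}) =
    (\<integral>\<^sup>+x. indicator {0} (sqnorm (Suc n) x) * ennreal ((1 / sqrt (2 * pi)) ^ Suc n * exp (- sqnorm (Suc n) x / 2)) \<partial>coord_lborel {..<Suc n})"
    by (rule nn_integral_quantile_map) measurable
  also have "\<dots> = (\<integral>\<^sup>+x. 0 \<partial>coord_lborel {..<Suc n})"
    by (rule nn_integral_cong_AE, use AE_sqnorm_neq_0[of n] in eventually_elim) simp
  also have "\<dots> = 0" by simp
  finally have "AE u in cube_uniform {..<Suc n}. indicator {0} (sqnorm (Suc n) (\<lambda>i\<in>{..<Suc n}. normal_quantile (u i))) = (0::ennreal)"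
    by (subst (asm) nn_integral_0_iff_AE) auto
  then show ?thesis by eventually_elim (auto simp: indicator_def)
qed

text \<open>Grid points converge in each coordinate, the quantile is continuous on the open
  interval, and the radial projection is continuous off the origin.\<close>

lemma gauss_direction_tendsto:
  assumes u: "u \<in> open_cube {..<Suc n}" and u0: "sqnorm (Suc n) (\<lambda>i\<in>{..<Suc n}. normal_quantile (u i)) \<noteq> 0"
  shows "(\<lambda>l. gauss_direction n (grid_point {..<Suc n} (coord_cycle (Suc n) l) u) i) \<longlonglongrightarrow> gauss_direction n u i"
proof -
  define P where "P l = grid_point {..<Suc n} (coord_cycle (Suc n) l) u" for l
  define x where "x = (\<lambda>i\<in>{..<Suc n}. normal_quantile (u i))"
  define X where "X l = (\<lambda>i\<in>{..<Suc n}. normal_quantile (P l i))" for l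
  have X: "(\<lambda>l. X l j) \<longlonglongrightarrow> x j" if "j < Suc n" for j
  proof -
    have "u j \<in> {0<..<1}" using PiE_mem[OF u, of j] that by simp
    then have "(\<lambda>l. normal_quantile (P l j)) \<longlonglongrightarrow> normal_quantile (u j)"
      unfolding P_def using u that
      by (intro isCont_tendsto_compose[OF isCont_normal_quantile] grid_point_tendsto)
    then show ?thesis using that by (simp add: X_def x_def)
  qed
  have sq: "(\<lambda>l. sqnorm (Suc n) (X l)) \<longlonglongrightarrow> sqnorm (Suc n) x"
    unfolding sqnorm_def by (intro tendsto_sum tendsto_power X) simp
  have nz: "sqnorm (Suc n) x \<noteq> 0" using u0 unfolding x_def .
  \<comment> \<open>At coarse levels the image of a grid point may be the origin, where
    \<open>direction\<close> takes its default value; hence the agreement holds only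
    eventually.\<close>
  then have ev: "\<forall>\<^sub>F l in sequentially. sqnorm (Suc n) (X l) \<noteq> 0"
    using sq by (rule tendsto_imp_eventually_ne[rotated])
  have "(\<lambda>l. radial_proj (Suc n) (X l) i) \<longlonglongrightarrow> radial_proj (Suc n) x i"
    unfolding radial_proj_def using nz by (cases "i < Suc n") (simp_all only: if_True if_False, auto intro!: tendsto_intros X sq)
  moreover have "\<forall>\<^sub>F l in sequentially. radial_proj (Suc n) (X l) i = direction n (X l) i"
    using ev by eventually_elim (simp add: direction_def)
  ultimately have "(\<lambda>l. direction n (X l) i) \<longlonglongrightarrow> radial_proj (Suc n) x i"
    by (rule Lim_transform_eventually)
  then have "(\<lambda>l. direction n (X l) i) \<longlonglongrightarrow> direction n x i" using nz by (simp add: direction_def)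
  then show ?thesis unfolding gauss_direction_def X_def x_def P_def .
qed

lemma nn_integral_gauss_direction:
  "(\<integral>\<^sup>+u. ennreal (edist (Suc n) (gauss_direction n u) q) \<partial>cube_uniform {..<Suc n})
    = ennreal ((1 / sqrt (2 * pi)) ^ Suc n) * gauss_mean_dist (Suc n) q"
proof -
  have [measurable]: "(\<lambda>x. edist (Suc n) (direction n x) q) \<in> borel_measurable (coord_lborel {..<Suc n})"
    unfolding edist_eq_sqnorm sqnorm_def using measurable_direction[measurable] by measurable
  note [measurable] = measurable_sqnorm measurable_edist_radial_proj
  have "(\<integral>\<^sup>+u. ennreal (edist (Suc n) (gauss_direction n u) q) \<partial>cube_uniform {..<Suc n}) =
    (\<integral>\<^sup>+x. ennreal (edist (Suc n) (direction n x) q) * ennreal ((1 / sqrt (2 * pi)) ^ Suc n * exp (- sqnorm (Suc n) x / 2)) \<partial>coord_lborel {..<Suc n})"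
    unfolding gauss_direction_def by (rule nn_integral_quantile_map) measurable
  also have "\<dots> = (\<integral>\<^sup>+x. ennreal ((1 / sqrt (2 * pi)) ^ Suc n) * ennreal (edist (Suc n) (radial_proj (Suc n) x) q * exp (- sqnorm (Suc n) x / 2)) \<partial>coord_lborel {..<Suc n})"
    by (rule nn_integral_cong_AE, use AE_sqnorm_neq_0[of n] in eventually_elim)
       (simp add: direction_def edist_nonneg mult_ac flip: ennreal_mult)
  also have "\<dots> = ennreal ((1 / sqrt (2 * pi)) ^ Suc n) * gauss_mean_dist (Suc n) q"
    unfolding gauss_mean_dist_def by (rule nn_integral_cmult) measurable
  finally show ?thesis .
qed

lemma measurable_edist_borel: "(\<lambda>x. edist k x q) \<in> borel_measurable borel"
proof -
  have [measurable]: "(\<lambda>x::nat \<Rightarrow> real. x i) \<in> borel_measurable borel" for i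
    by (rule measurable_product_coordinates)
  show ?thesis unfolding edist_eq_sqnorm sqnorm_def by measurable
qed

text \<open>The polar formula is used twice, for the distance to \<open>q\<close> and for the
  constant 1. The same radial factor occurs in both and cancels in the quotient.\<close>

lemma nn_integral_gauss_direction_eq_mean_dist:
  assumes q: "q \<in> topspace (nsphere n)"
  shows "(\<integral>\<^sup>+u. ennreal (edist (Suc n) (gauss_direction n u) q) \<partial>cube_uniform {..<Suc n}) = ennreal (mean_dist n q)"
proof -
  note [measurable] = measurable_sqnorm measurable_edist_borel
  interpret prob_space "cube_uniform {..<Suc n}" by (rule prob_space_cube_uniform)
  define c where "c = ennreal ((1 / sqrt (2 * pi)) ^ Suc n)"
  define K where "K = (\<integral>\<^sup>+t. ennreal (t ^ n * exp (- t\<^sup>2 / 2)) * indicator {0<..} t \<partial>lborel)"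
  define A where "A = (\<integral>\<^sup>+x. ennreal (edist (Suc n) x q) \<partial>sphere_volume n)"
  define V where "V = (\<integral>\<^sup>+x. 1 \<partial>sphere_volume n)"
  define X where "X = (\<integral>\<^sup>+u. ennreal (edist (Suc n) (gauss_direction n u) q) \<partial>cube_uniform {..<Suc n})"
  have "(\<integral>\<^sup>+x. ennreal (edist (Suc n) (radial_proj (Suc n) x) q) * ennreal (exp (- sqnorm (Suc n) x / 2)) \<partial>coord_lborel {..<Suc n}) = K * A"
    unfolding K_def A_def by (rule nn_integral_gauss_polar) measurable
  then have "gauss_mean_dist (Suc n) q = K * A"
    unfolding gauss_mean_dist_def by (simp add: ennreal_mult edist_nonneg)
  then have X: "X = c * K * A" unfolding X_def nn_integral_gauss_direction c_def by (simp add: mult.assoc)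
  have "(\<integral>\<^sup>+u. 1 \<partial>cube_uniform {..<Suc n}) =
    (\<integral>\<^sup>+x. 1 * ennreal ((1 / sqrt (2 * pi)) ^ Suc n * exp (- sqnorm (Suc n) x / 2)) \<partial>coord_lborel {..<Suc n})"
    by (rule nn_integral_quantile_map[of "\<lambda>_. 1"]) simp
  also have "\<dots> = (\<integral>\<^sup>+x. c * ennreal (exp (- sqnorm (Suc n) x / 2)) \<partial>coord_lborel {..<Suc n})"
    unfolding c_def by (intro nn_integral_cong) (simp flip: ennreal_mult)
  also have "\<dots> = c * (\<integral>\<^sup>+x. 1 * ennreal (exp (- sqnorm (Suc n) x / 2)) \<partial>coord_lborel {..<Suc n})"
    by (subst nn_integral_cmult) auto
  also have "(\<integral>\<^sup>+x. 1 * ennreal (exp (- sqnorm (Suc n) x / 2)) \<partial>coord_lborel {..<Suc n}) = K * V"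
    unfolding K_def V_def by (rule nn_integral_gauss_polar[of "\<lambda>_. 1"]) simp
  \<comment> \<open>The cube has mass 1, so \<open>c * K\<close> is the reciprocal of the volume of
    the sphere. Neither constant has to be computed, and both are finite and nonzero.\<close>
  finally have V: "c * K * V = 1" by (simp add: emeasure_space_1 mult.assoc)
  then have nz: "c * K \<noteq> 0" "V \<noteq> 0" by auto
  have "(c * K) * V \<noteq> \<infinity>" using V by simp
  then have "c * K \<noteq> \<infinity>" "V \<noteq> \<infinity>"
    using nz unfolding infinity_ennreal_def ennreal_mult_eq_top_iff[of "c * K" V] by blast+
  have "X \<le> (\<integral>\<^sup>+u. 2 \<partial>cube_uniform {..<Suc n})"
    unfolding X_def
  proof (rule nn_integral_mono)
    fix u
    have "ennreal (edist (Suc n) (gauss_direction n u) q) \<le> ennreal 2"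
      using q by (intro ennreal_leI edist_nsphere_le_2) (auto simp: gauss_direction_def direction_in_nsphere)
    then show "ennreal (edist (Suc n) (gauss_direction n u) q) \<le> 2" by simp
  qed
  then have "X \<le> 2" by (simp add: emeasure_space_1)
  then have "X < \<infinity>" by (rule order_le_less_trans) simp
  then have "A \<noteq> \<infinity>"
    using X nz unfolding infinity_ennreal_def by (metis ennreal_mult_eq_top_iff less_irrefl)
  then obtain a v \<kappa> where avk: "A = ennreal a" "V = ennreal v" "c * K = ennreal \<kappa>" "0 \<le> a" "0 \<le> v" "0 \<le> \<kappa>"
    using \<open>V \<noteq> \<infinity>\<close> \<open>c * K \<noteq> \<infinity>\<close> by (metis ennreal_cases infinity_ennreal_def)
  have "\<kappa> * v = 1" using V avk by (simp flip: ennreal_mult ennreal_1)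
  moreover from this have "v \<noteq> 0" by auto
  ultimately have "\<kappa> = 1 / v" by (simp add: eq_divide_eq)
  then have Xav: "X = ennreal (a / v)" using X avk by (simp flip: ennreal_mult)
  have sp: "space (sphere_volume n) = topspace (nsphere n)"
    by (simp add: sphere_volume_def space_restrict_space)
  have "(\<integral>x. edist (Suc n) x q \<partial>sphere_volume n) = a"
  proof -
    have "(\<lambda>x. edist (Suc n) x q) \<in> borel_measurable (sphere_volume n)"
      unfolding sphere_volume_def measurable_distr_eq1 by (intro measurable_restrict_space1) measurable
    then have "(\<integral>x. edist (Suc n) x q \<partial>sphere_volume n) = enn2real A"
      unfolding A_def by (intro integral_eq_nn_integral) (auto simp: edist_nonneg)
    then show ?thesis using avk by simp
  qed
  moreover have "measure (sphere_volume n) (topspace (nsphere n)) = v"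
    using avk by (simp add: V_def measure_def flip: sp)
  ultimately show ?thesis using Xav by (simp add: mean_dist_def X_def)
qed

lemma mean_dist_nonneg: "0 \<le> mean_dist n q"
  unfolding mean_dist_def by (intro divide_nonneg_nonneg integral_nonneg_AE) (auto simp: edist_nonneg)

lemma mean_dist_const:
  assumes "p \<in> topspace (nsphere n)" "q \<in> topspace (nsphere n)"
  shows "mean_dist n p = mean_dist n q"
proof -
  have "gauss_mean_dist (Suc n) p = gauss_mean_dist (Suc n) q"
    using assms by (simp only: gauss_mean_dist_pole)
  then have "ennreal (mean_dist n p) = ennreal (mean_dist n q)"
    using assms by (simp only: nn_integral_gauss_direction flip: nn_integral_gauss_direction_eq_mean_dist)
  then show ?thesis by (simp add: mean_dist_nonneg)
qed

lemma measurable_edist_gauss_direction: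
  "(\<lambda>u. edist (Suc n) (gauss_direction n u) q) \<in> borel_measurable (cube_uniform {..<Suc n})"
proof -
  have "(\<lambda>x. edist (Suc n) (direction n x) q) \<in> borel_measurable (coord_lborel {..<Suc n})"
    unfolding edist_eq_sqnorm sqnorm_def using measurable_direction[measurable] by measurable
  then show ?thesis unfolding gauss_direction_def by (rule measurable_compose[OF measurable_quantile_map])
qed

text \<open>The mean over the sphere is the same for \<open>q\<close> and \<open>- q\<close>, and
  the two distances add up to at most \<open>2 * sqrt 2\<close> at every point.\<close>

lemma mean_dist_le_sqrt_2:
  assumes q: "q \<in> topspace (nsphere n)"
  shows "mean_dist n q \<le> sqrt 2"
proof -
  interpret prob_space "cube_uniform {..<Suc n}" by (rule prob_space_cube_uniform)
  note [measurable] = measurable_edist_gauss_direction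
  define q' where "q' = (\<lambda>i. - q i)"
  have q': "q' \<in> topspace (nsphere n)" using q by (simp add: q'_def in_nsphere_iff sqnorm_def)
  have "ennreal (mean_dist n q + mean_dist n q') = (\<integral>\<^sup>+u. ennreal (edist (Suc n) (gauss_direction n u) q)
      + ennreal (edist (Suc n) (gauss_direction n u) q') \<partial>cube_uniform {..<Suc n})"
    by (subst nn_integral_add)
       (simp_all add: nn_integral_gauss_direction_eq_mean_dist[OF q] nn_integral_gauss_direction_eq_mean_dist[OF q'] mean_dist_nonneg)
  also have "\<dots> \<le> (\<integral>\<^sup>+u. ennreal (2 * sqrt 2) \<partial>cube_uniform {..<Suc n})"
  proof (rule nn_integral_mono)
    fix u
    have "gauss_direction n u \<in> topspace (nsphere n)" by (simp add: gauss_direction_def direction_in_nsphere)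
    then have "edist (Suc n) (gauss_direction n u) q + edist (Suc n) (gauss_direction n u) q' \<le> 2 * sqrt 2"
      unfolding q'_def using q by (rule edist_nsphere_antipode)
    then show "ennreal (edist (Suc n) (gauss_direction n u) q) + ennreal (edist (Suc n) (gauss_direction n u) q') \<le> ennreal (2 * sqrt 2)"
      by (simp add: edist_nonneg ennreal_leI flip: ennreal_plus)
  qed
  also have "\<dots> = ennreal (2 * sqrt 2)" by (simp add: emeasure_space_1)
  finally have "mean_dist n q + mean_dist n q' \<le> 2 * sqrt 2" by (subst (asm) ennreal_le_iff) auto
  then show ?thesis using mean_dist_const[OF q q'] by simp
qed

section \<open>Lipschitz extension to the ball\<close>

lemma continuous_map_sqnorm: "continuous_map (Euclidean_space k) euclideanreal (sqnorm k)"
proof -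
  have "continuous_map (Euclidean_space k) euclideanreal (\<lambda>x. x i)" for i
    unfolding Euclidean_space_def
    by (intro continuous_map_from_subtopology continuous_map_product_projection) simp
  then show ?thesis unfolding sqnorm_def[abs_def]
    by (intro continuous_map_sum continuous_map_real_pow) auto
qed

lemma unit_eball_eq: "unit_eball k = {x \<in> topspace (Euclidean_space k). sqnorm k x \<le> 1}"
  by (simp add: unit_eball_def edist_eq_sqnorm)

lemma frontier_unit_eball: "Euclidean_space (Suc n) frontier_of unit_eball (Suc n) = topspace (nsphere n)"
proof -
  let ?X = "Euclidean_space (Suc n)"
  have nsphere: "topspace (nsphere n) = {x \<in> topspace ?X. sqnorm (Suc n) x = 1}"
    by (auto simp: in_nsphere_iff topspace_Euclidean_space Suc_le_eq)
  have "closedin ?X {x \<in> topspace ?X. sqnorm (Suc n) x \<in> {..1}}"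
    by (rule closedin_continuous_map_preimage[OF continuous_map_sqnorm]) simp
  then have closed: "closedin ?X (unit_eball (Suc n))" by (simp add: unit_eball_eq)
  have "openin ?X {x \<in> topspace ?X. sqnorm (Suc n) x \<in> {..<1}}"
    by (rule openin_continuous_map_preimage[OF continuous_map_sqnorm]) simp
  then have int1: "{x \<in> topspace ?X. sqnorm (Suc n) x < 1} \<subseteq> ?X interior_of unit_eball (Suc n)"
    by (intro interior_of_maximal) (auto simp: unit_eball_eq)
  have int2: "x \<notin> ?X interior_of unit_eball (Suc n)" if x: "x \<in> topspace (nsphere n)" for x
  proof
    assume "x \<in> ?X interior_of unit_eball (Suc n)"
    then obtain T where T: "openin ?X T" "x \<in> T" "T \<subseteq> unit_eball (Suc n)" by (auto simp: interior_of_def)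
    \<comment> \<open>The ray through \<open>x\<close>, which leaves the ball just after parameter
      1; an open neighbourhood of \<open>x\<close> inside the ball would contain a bit of
      it.\<close>
    define l where "l t = (\<lambda>i. if i < Suc n then t * x i else 0)" for t :: real
    have "continuous_map euclideanreal ?X l"
      unfolding l_def continuous_map_componentwise_Euclidean_space by (auto intro!: continuous_intros)
    then have "openin euclideanreal {t \<in> topspace euclideanreal. l t \<in> T}"
      using T(1) by (rule openin_continuous_map_preimage)
    then have "open {t. l t \<in> T}" by simp
    moreover have "l 1 = x" using x by (auto simp: l_def in_nsphere_iff fun_eq_iff)
    ultimately obtain e where e: "e > 0" "\<And>t. dist t 1 < e \<Longrightarrow> l t \<in> T"
      using T(2) unfolding open_dist by force
    have "l (1 + e / 2) \<in> unit_eball (Suc n)" using e T(3) by (auto simp: dist_real_def)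
    then have "sqnorm (Suc n) (l (1 + e / 2)) \<le> 1" by (simp add: unit_eball_eq)
    moreover have "sqnorm (Suc n) (l t) = t\<^sup>2 * sqnorm (Suc n) x" for t
      unfolding sqnorm_def sum_distrib_left by (intro sum.cong) (auto simp: l_def power_mult_distrib)
    ultimately have "(1 + e / 2)\<^sup>2 \<le> 1" using x by (simp add: in_nsphere_iff)
    moreover have "1\<^sup>2 < (1 + e / 2)\<^sup>2" using e(1) by (intro power_strict_mono) auto
    ultimately show False by simp
  qed
  have "?X frontier_of unit_eball (Suc n) = unit_eball (Suc n) - ?X interior_of unit_eball (Suc n)"
    using closed by (simp add: frontier_of_def closure_of_closedin)
  also have "\<dots> = topspace (nsphere n)"
    using int1 int2 unfolding nsphere unit_eball_eq by force
  finally show ?thesis .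
qed

lemma LC_mono:
  assumes "LC k K c Y" "c \<le> c'"
  shows "LC k K c' Y"
  unfolding LC_def
proof (intro allI impI, elim conjE)
  fix L f
  assume f: "f \<in> Euclidean_space k frontier_of K \<rightarrow> Y" and L: "elipschitz_on k L (Euclidean_space k frontier_of K) f"
  then obtain F where F: "F \<in> K \<rightarrow> Y" "elipschitz_on k (c * L) K F" "\<forall>x\<in>Euclidean_space k frontier_of K. F x = f x"
    using assms(1) unfolding LC_def by blast
  have cL: "c * L \<le> c' * L" "0 \<le> c * L"
    using L F(2) assms(2) by (auto simp: elipschitz_on_def intro: mult_right_mono)
  have "elipschitz_on k (c' * L) K F"
    unfolding elipschitz_on_def
  proof (intro conjI ballI)
    show "0 \<le> c' * L" using cL by linarith
    fix x y assume "x \<in> K" "y \<in> K"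
    then have "dist (F x) (F y) \<le> c * L * edist k x y" using F(2) by (simp add: elipschitz_on_def)
    also have "\<dots> \<le> c' * L * edist k x y" by (rule mult_right_mono[OF cL(1) edist_nonneg])
    finally show "dist (F x) (F y) \<le> c' * L * edist k x y" .
  qed
  then show "\<exists>F. F \<in> K \<rightarrow> Y \<and> elipschitz_on k (c' * L) K F \<and> (\<forall>x\<in>Euclidean_space k frontier_of K. F x = f x)"
    using F by blast
qed

text \<open>Applied to the vectors \<open>(a, b)\<close> and \<open>(1, c)\<close>, with
  \<open>a\<close> the tangential and \<open>b\<close> the radial displacement in the cone.\<close>

lemma Cauchy_Schwarz_2: "a * 1 + b * c \<le> sqrt (1 + c\<^sup>2) * sqrt (a\<^sup>2 + b\<^sup>2)" for a b c :: real
proof -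
  have "(a * 1 + b * c)\<^sup>2 \<le> (1 + c\<^sup>2) * (a\<^sup>2 + b\<^sup>2)"
    using zero_le_power2[of "a * c - b"] by (simp add: power2_eq_square algebra_simps)
  then show ?thesis by (simp add: real_le_rsqrt flip: real_sqrt_mult)
qed

lemma (in midpoint_space) LC_unit_eball:
  assumes "complete Y" and q0: "q0 \<in> topspace (nsphere n)"
  shows "LC (Suc n) (unit_eball (Suc n)) (sqrt (1 + (mean_dist n q0)\<^sup>2)) Y"
  unfolding LC_def frontier_unit_eball
proof (intro allI impI, elim conjE)
  fix L f
  let ?S = "topspace (nsphere n)" and ?d = "edist (Suc n)"
  define c where "c = mean_dist n q0"
  have c0: "0 \<le> c" by (simp add: c_def mean_dist_nonneg)
  assume f: "f \<in> ?S \<rightarrow> Y" and "elipschitz_on (Suc n) L ?S f"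
  then have L: "0 \<le> L" and fL: "\<And>x y. \<lbrakk>x \<in> ?S; y \<in> ?S\<rbrakk> \<Longrightarrow> dist (f x) (f y) \<le> L * ?d x y"
    by (auto simp: elipschitz_on_def)
  have fY: "f x \<in> Y" if "x \<in> ?S" for x using f that by blast
  have gS: "gauss_direction n u \<in> ?S" for u by (simp add: gauss_direction_def direction_in_nsphere)
  have meas: "(\<lambda>u. gauss_direction n u i) \<in> borel_measurable (cube_uniform {..<Suc n})" for i
    unfolding gauss_direction_def by (rule measurable_compose[OF measurable_quantile_map measurable_direction])
  have conv: "AE u in cube_uniform {..<Suc n}.
     (\<lambda>l. gauss_direction n (grid_point {..<Suc n} (coord_cycle (Suc n) l) u) i) \<longlonglongrightarrow> gauss_direction n u i" for i
  proof -
    have "AE u in cube_uniform {..<Suc n}. u \<in> open_cube {..<Suc n}" by (rule AE_open_cube) simp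
    then show ?thesis using AE_quantile_map_neq_0[of n] by eventually_elim (rule gauss_direction_tendsto)
  qed
  obtain b where b: "b \<in> Y" and b_le: "\<And>y q. \<lbrakk>y \<in> Y; \<And>u. u \<in> open_cube {..<Suc n} \<Longrightarrow> dist (f (gauss_direction n u)) y \<le> L * ?d (gauss_direction n u) q\<rbrakk> \<Longrightarrow>
      ennreal (dist b y) \<le> ennreal L * (\<integral>\<^sup>+u. ennreal (?d (gauss_direction n u) q) \<partial>cube_uniform {..<Suc n})"
  proof (rule ex_barycenter[OF assms(1), of "\<lambda>u. f (gauss_direction n u)" "Suc n" L "Suc n" "gauss_direction n" 2])
    show "(\<lambda>u. f (gauss_direction n u)) \<in> open_cube {..<Suc n} \<rightarrow> Y" using gS fY by blast
    show "?d (gauss_direction n u) (gauss_direction n v) \<le> 2" for u v by (intro edist_nsphere_le_2 gS)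
    show "dist (f (gauss_direction n u)) (f (gauss_direction n v)) \<le> L * ?d (gauss_direction n u) (gauss_direction n v)" for u v
      by (intro fL gS)
  qed (use L meas conv in auto)
  have bf: "dist b (f q) \<le> L * c" if q: "q \<in> ?S" for q
  proof -
    have "ennreal (dist b (f q)) \<le> ennreal L * (\<integral>\<^sup>+u. ennreal (?d (gauss_direction n u) q) \<partial>cube_uniform {..<Suc n})"
      \<comment> \<open>The comparison point is \<open>y = f q\<close>; the Lipschitz condition on
        \<open>f\<close> is precisely the domination that the barycenter bound asks for.\<close>
      using q by (intro b_le fY fL gS)
    also have "\<dots> = ennreal (L * c)"
      using L c0 mean_dist_const[OF q q0] by (simp add: nn_integral_gauss_direction_eq_mean_dist[OF q] c_def ennreal_mult)
    finally show ?thesis using L c0 by (simp add: ennreal_le_iff)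
  qed
  obtain \<gamma> :: "real \<Rightarrow> 'a \<Rightarrow> 'a \<Rightarrow> 'a" where \<gamma>_in: "\<And>t x y. \<lbrakk>x \<in> Y; y \<in> Y\<rbrakk> \<Longrightarrow> \<gamma> t x y \<in> Y"
    and \<gamma>_1: "\<And>x y. \<lbrakk>x \<in> Y; y \<in> Y\<rbrakk> \<Longrightarrow> \<gamma> 1 x y = y"
    and \<gamma>_lip: "\<And>s t x y. \<lbrakk>x \<in> Y; y \<in> Y; s \<in> {0..1}; t \<in> {0..1}\<rbrakk> \<Longrightarrow> dist (\<gamma> s x y) (\<gamma> t x y) \<le> \<bar>s - t\<bar> * dist x y"
    and \<gamma>_con: "\<And>t x y y'. \<lbrakk>x \<in> Y; y \<in> Y; y' \<in> Y; t \<in> {0..1}\<rbrakk> \<Longrightarrow> dist (\<gamma> t x y) (\<gamma> t x y') \<le> t * dist y y'"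
    using ex_conical_geodesics[OF assms(1)] by blast
  define F where "F x = \<gamma> (sqrt (sqnorm (Suc n) x)) b (f (direction n x))" for x
  \<comment> \<open>The path from \<open>F x\<close> to \<open>F y\<close> changes direction at the
    radius \<open>r\<close> of \<open>x\<close>, the smaller one; the remaining case follows by
    exchanging \<open>x\<close> and \<open>y\<close>.\<close>
  have F_le: "dist (F x) (F y) \<le> sqrt (1 + c\<^sup>2) * L * ?d x y"
    if x: "sqnorm (Suc n) x \<le> 1" and y: "sqnorm (Suc n) y \<le> 1" and xy: "sqnorm (Suc n) x \<le> sqnorm (Suc n) y" for x y
  proof -
    define r where "r = sqrt (sqnorm (Suc n) x)"
    define s where "s = sqrt (sqnorm (Suc n) y)"
    have rs: "0 \<le> r" "r \<le> s" "s \<le> 1" using x y xy by (auto simp: r_def s_def sqnorm_nonneg)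
    define p where "p = direction n x"
    define q where "q = direction n y"
    have pq: "p \<in> ?S" "q \<in> ?S" by (simp_all add: p_def q_def direction_in_nsphere)
    have "?d x y = ?d (\<lambda>i. r * p i) (\<lambda>i. s * q i)"
      unfolding edist_def p_def q_def r_def s_def
      by (intro L2_set_cong refl) (simp add: sqrt_sqnorm_times_direction)
    then have dxy: "(?d x y)\<^sup>2 = (r - s)\<^sup>2 + r * s * (?d p q)\<^sup>2"
      using edist_nsphere_sq[OF pq, of r s] by simp
    have "(r * ?d p q)\<^sup>2 + (s - r)\<^sup>2 \<le> (?d x y)\<^sup>2"
    proof -
      \<comment> \<open>The arc at the smaller radius is no longer than the chord term
        \<open>r * s * (?d p q)\<^sup>2\<close> permits, so the squares of the two displacements add
        up to at most \<open>(?d x y)\<^sup>2\<close>.\<close>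
      have "r * r \<le> r * s" using rs by (intro mult_left_mono) auto
      then have "r * r * (?d p q)\<^sup>2 \<le> r * s * (?d p q)\<^sup>2" by (intro mult_right_mono) auto
      then show ?thesis unfolding dxy by (simp add: power2_eq_square algebra_simps)
    qed
    then have sq: "sqrt ((r * ?d p q)\<^sup>2 + (s - r)\<^sup>2) \<le> ?d x y"
      by (intro real_le_lsqrt) (auto simp: edist_nonneg)
    have "dist (F x) (F y) \<le> dist (\<gamma> r b (f p)) (\<gamma> r b (f q)) + dist (\<gamma> r b (f q)) (\<gamma> s b (f q))"
      unfolding F_def r_def[symmetric] s_def[symmetric] p_def[symmetric] q_def[symmetric] by (rule dist_triangle)
    also have "\<dots> \<le> r * dist (f p) (f q) + \<bar>r - s\<bar> * dist b (f q)"
      using rs by (intro add_mono \<gamma>_con \<gamma>_lip b fY pq) auto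
    also have "\<dots> \<le> r * (L * ?d p q) + \<bar>r - s\<bar> * (L * c)"
      using rs pq by (intro add_mono mult_left_mono fL bf) auto
    also have "\<dots> = L * ((r * ?d p q) * 1 + (s - r) * c)"
      using rs by (simp add: algebra_simps)
    also have "\<dots> \<le> L * (sqrt (1 + c\<^sup>2) * sqrt ((r * ?d p q)\<^sup>2 + (s - r)\<^sup>2))"
      using L by (intro mult_left_mono Cauchy_Schwarz_2)
    also have "\<dots> \<le> L * (sqrt (1 + c\<^sup>2) * ?d x y)"
      using L sq by (intro mult_left_mono) auto
    finally show ?thesis by (simp add: mult_ac)
  qed
  show "\<exists>F. F \<in> unit_eball (Suc n) \<rightarrow> Y \<and>
        elipschitz_on (Suc n) (sqrt (1 + (mean_dist n q0)\<^sup>2) * L) (unit_eball (Suc n)) F \<and> (\<forall>x\<in>?S. F x = f x)"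
  proof (intro exI[of _ F] conjI ballI)
    show "F \<in> unit_eball (Suc n) \<rightarrow> Y"
      unfolding F_def by (intro funcsetI \<gamma>_in b fY direction_in_nsphere)
    show "elipschitz_on (Suc n) (sqrt (1 + (mean_dist n q0)\<^sup>2) * L) (unit_eball (Suc n)) F"
      unfolding elipschitz_on_def c_def[symmetric]
    proof (intro conjI ballI)
      show "0 \<le> sqrt (1 + c\<^sup>2) * L" using L by simp
      fix x y assume "x \<in> unit_eball (Suc n)" "y \<in> unit_eball (Suc n)"
      then have "sqnorm (Suc n) x \<le> 1" "sqnorm (Suc n) y \<le> 1" by (auto simp: unit_eball_eq)
      then show "dist (F x) (F y) \<le> sqrt (1 + c\<^sup>2) * L * ?d x y"
        using F_le[of x y] F_le[of y x] by (cases "sqnorm (Suc n) x \<le> sqnorm (Suc n) y") (auto simp: dist_commute edist_commute)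
    qed
    show "F x = f x" if "x \<in> ?S" for x
      using that \<gamma>_1[OF b fY[OF that]] by (simp add: F_def direction_nsphere in_nsphere_iff)
  qed
qed

theorem proposition7p3:
  fixes Y :: "'a::metric_space set"
  assumes "complete Y" and "generalized_nonpos_curved Y"
  shows "(\<forall>n. \<forall>q \<in> topspace (nsphere n).
            LC (Suc n) (unit_eball (Suc n)) (sqrt (1 + (mean_dist n q)\<^sup>2)) Y)
         \<and> (\<forall>n. Lipschitz_connected n (sqrt 3) Y)"
proof -
  obtain mid where "midpoint_space Y mid"
    using assms(2) unfolding generalized_nonpos_curved_def midpoint_space_def by blast
  then interpret midpoint_space Y mid .
  have LC: "LC (Suc n) (unit_eball (Suc n)) (sqrt (1 + (mean_dist n q)\<^sup>2)) Y"
    if "q \<in> topspace (nsphere n)" for n q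
    using assms(1) that by (rule LC_unit_eball)
  have "LC (Suc m) (unit_eball (Suc m)) (sqrt 3) Y" for m
  proof (rule LC_mono)
    \<comment> \<open>Any point of the sphere would serve; the direction of the origin is the
      pole.\<close>
    let ?q = "direction m (\<lambda>_. 0)"
    have q: "?q \<in> topspace (nsphere m)" by (rule direction_in_nsphere)
    then show "LC (Suc m) (unit_eball (Suc m)) (sqrt (1 + (mean_dist m ?q)\<^sup>2)) Y" by (rule LC)
    have "(mean_dist m ?q)\<^sup>2 \<le> (sqrt 2)\<^sup>2"
      using mean_dist_le_sqrt_2[OF q] mean_dist_nonneg by (rule power_mono)
    then show "sqrt (1 + (mean_dist m ?q)\<^sup>2) \<le> sqrt 3" by simp
  qed
  then show ?thesis using LC by (simp add: Lipschitz_connected_def)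
qed

end
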